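(* Let $G$ be a conjugacy separable, relatively hyperbolic group. Then each virtually torsion-free subgroup of the outer automorphism group $\mathrm{Out}(G)$ of $G$ is residually finite.
   Context: A finitely generated group $G$ is hyperbolic relative to a family $\mathcal{G}$ of finitely generated subgroups if $G$ admits a proper, discontinuous and isometric action on a proper, hyperbolic path metric space $X$ such that $G$ acts on the ideal boundary $\partial X$ of $X$ as a geometrically finite convergence group and the elements of $\mathcal{G}$ are the maximal parabolic subgroups of $G$ (this is one of Bowditch's equivalent definitions). Here geometrically finite means that every point of $\partial X$ is either a conical limit point or a bounded parabolic point. A point $p\in\partial X$ is a conical limit point if there are a sequence $(g_n)$ in $G$ and distinct points $a\ne b$ in $\partial X$ with $g_np\to a$ and $g_nx\to b$ for all $x\in\partial X\setminus\{p\}$. A point $p$ is bounded parabolic if its stabilizer $G_p$ is infinite, contains no loxodromic element, and acts cocompactly on $\partial X\setminus\{p\}$; the maximal parabolic subgroups are the stabilizers of such points. $G$ is relatively hyperbolic if it is hyperbolic relative to some such family $\mathcal{G}$. A group $G$ is conjugacy separable if any two non-conjugate elements of $G$ have non-conjugate images in some finite quotient of $G$. $\mathrm{Out}(G)=\mathrm{Aut}(G)/\mathrm{Inn}(G)$, where $\mathrm{Inn}(G)$ is the group of inner automorphisms. A group is virtually torsion-free if it has a torsion-free subgroup of finite index. A group is residually finite if the intersection of its finite-index subgroups is trivial. *)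

theory Defs
  imports "HOL-Analysis.Analysis" "HOL-Algebra.Group_Action" "HOL-Algebra.Generated_Groups"
begin

section \<open>Group-theoretic notions\<close>

definition fin_gen :: "('a, 'b) monoid_scheme \<Rightarrow> 'a set \<Rightarrow> bool" where
  "fin_gen G H \<longleftrightarrow> (\<exists>S. finite S \<and> S \<subseteq> H \<and> generate G S = H)"

definition conj_in :: "('a, 'b) monoid_scheme \<Rightarrow> 'a \<Rightarrow> 'a \<Rightarrow> bool" where
  "conj_in G x y \<longleftrightarrow> (\<exists>g\<in>carrier G. y = g \<otimes>\<^bsub>G\<^esub> x \<otimes>\<^bsub>G\<^esub> inv\<^bsub>G\<^esub> g)"

definition conjugacy_separable :: "('a, 'b) monoid_scheme \<Rightarrow> bool" where
  "conjugacy_separable G \<longleftrightarrow>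
     (\<forall>x\<in>carrier G. \<forall>y\<in>carrier G. \<not> conj_in G x y \<longrightarrow>
        (\<exists>N. N \<lhd> G \<and> finite (carrier (G Mod N)) \<and>
             \<not> conj_in (G Mod N) (N #>\<^bsub>G\<^esub> x) (N #>\<^bsub>G\<^esub> y)))"

definition Inn :: "('a, 'b) monoid_scheme \<Rightarrow> ('a \<Rightarrow> 'a) set" where
  "Inn G = (\<lambda>g. \<lambda>x\<in>carrier G. g \<otimes>\<^bsub>G\<^esub> x \<otimes>\<^bsub>G\<^esub> inv\<^bsub>G\<^esub> g) ` carrier G"

definition OutGroup :: "('a, 'b) monoid_scheme \<Rightarrow> ('a \<Rightarrow> 'a) set monoid" where
  "OutGroup G = AutoGroup G Mod Inn G"

definition torsion_free :: "('a, 'b) monoid_scheme \<Rightarrow> bool" where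
  "torsion_free G \<longleftrightarrow> (\<forall>x\<in>carrier G. \<forall>n::nat. 0 < n \<and> x [^]\<^bsub>G\<^esub> n = \<one>\<^bsub>G\<^esub> \<longrightarrow> x = \<one>\<^bsub>G\<^esub>)"

definition finite_index :: "('a, 'b) monoid_scheme \<Rightarrow> 'a set \<Rightarrow> bool" where
  "finite_index G H \<longleftrightarrow> subgroup H G \<and> finite (rcosets\<^bsub>G\<^esub> H)"

definition virtually_torsion_free :: "('a, 'b) monoid_scheme \<Rightarrow> bool" where
  "virtually_torsion_free G \<longleftrightarrow> (\<exists>H. finite_index G H \<and> torsion_free (G\<lparr>carrier := H\<rparr>))"

definition residually_finite :: "('a, 'b) monoid_scheme \<Rightarrow> bool" where
  "residually_finite G \<longleftrightarrow> \<Inter>{H. finite_index G H} = {\<one>\<^bsub>G\<^esub>}"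


section \<open>Proper hyperbolic path metric spaces\<close>

definition proper_metric :: "'x metric \<Rightarrow> bool" where
  "proper_metric m \<longleftrightarrow>
     (\<forall>x\<in>mspace m. \<forall>r. compactin (mtopology_of m) (mcball_of m x r))"

definition curve_length :: "'x metric \<Rightarrow> (real \<Rightarrow> 'x) \<Rightarrow> ereal" where
  "curve_length m \<gamma> =
     (SUP (n, t) \<in> {(n::nat, t::nat \<Rightarrow> real). mono_on {..n} t \<and> t ` {..n} \<subseteq> {0..1}}.
        ereal (\<Sum>i<n. mdist m (\<gamma> (t i)) (\<gamma> (t (Suc i)))))"

text \<open>The infimum over an empty set of paths is \<open>\<infinity>\<close>, so path metric spaces are path connected.\<close>

definition path_metric :: "'x metric \<Rightarrow> bool" where
  "path_metric m \<longleftrightarrow>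
     (\<forall>x\<in>mspace m. \<forall>y\<in>mspace m.
        ereal (mdist m x y) =
          (INF \<gamma> \<in> {\<gamma>. pathin (mtopology_of m) \<gamma> \<and> \<gamma> 0 = x \<and> \<gamma> 1 = y}. curve_length m \<gamma>))"

definition gromov_prod :: "'x metric \<Rightarrow> 'x \<Rightarrow> 'x \<Rightarrow> 'x \<Rightarrow> real" where
  "gromov_prod m w x y = (mdist m x w + mdist m y w - mdist m x y) / 2"

definition gromov_hyperbolic :: "'x metric \<Rightarrow> bool" where
  "gromov_hyperbolic m \<longleftrightarrow>
     (\<exists>\<delta>. \<forall>w\<in>mspace m. \<forall>x\<in>mspace m. \<forall>y\<in>mspace m. \<forall>z\<in>mspace m.
        min (gromov_prod m w x y) (gromov_prod m w y z) - \<delta> \<le> gromov_prod m w x z)"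


section \<open>The ideal boundary\<close>

text \<open>
  The sequential model: boundary points are classes of sequences \<open>s\<close> with
  \<open>(s\<^sub>i | s\<^sub>j) \<rightarrow> \<infinity>\<close> as \<open>i, j \<rightarrow> \<infinity>\<close>, where \<open>s\<close> and \<open>t\<close> are identified
  if \<open>(s\<^sub>i | t\<^sub>j) \<rightarrow> \<infinity>\<close>.  None of the conditions below depends on the base point \<open>w\<close>, so
  quantifying over all \<open>w\<close> avoids choosing one.
\<close>

definition diverge_together :: "'x metric \<Rightarrow> (nat \<Rightarrow> 'x) \<Rightarrow> (nat \<Rightarrow> 'x) \<Rightarrow> bool" where
  "diverge_together m s t \<longleftrightarrow>
     (\<forall>w\<in>mspace m. filterlim (\<lambda>(i, j). gromov_prod m w (s i) (t j)) at_top
        (sequentially \<times>\<^sub>F sequentially))"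

definition gromov_seqs :: "'x metric \<Rightarrow> (nat \<Rightarrow> 'x) set" where
  "gromov_seqs m = {s. range s \<subseteq> mspace m \<and> diverge_together m s s}"

definition ideal_boundary :: "'x metric \<Rightarrow> (nat \<Rightarrow> 'x) set set" where
  "ideal_boundary m =
     gromov_seqs m // {(s, t). s \<in> gromov_seqs m \<and> t \<in> gromov_seqs m \<and> diverge_together m s t}"

definition boundary_prod ::
    "'x metric \<Rightarrow> 'x \<Rightarrow> (nat \<Rightarrow> 'x) set \<Rightarrow> (nat \<Rightarrow> 'x) set \<Rightarrow> ereal" where
  "boundary_prod m w p q =
     (SUP (s, t) \<in> p \<times> q.
        Liminf (sequentially \<times>\<^sub>F sequentially) (\<lambda>(i, j). ereal (gromov_prod m w (s i) (t j))))"

text \<open>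
  The usual topology, in which the sets \<open>{q. (p | q)\<^sub>w > R}\<close> for real \<open>R\<close> form a neighbourhood
  base at \<open>p\<close>.
\<close>

definition boundary_open :: "'x metric \<Rightarrow> (nat \<Rightarrow> 'x) set set \<Rightarrow> bool" where
  "boundary_open m U \<longleftrightarrow> U \<subseteq> ideal_boundary m \<and>
     (\<forall>p\<in>U. \<forall>w\<in>mspace m. \<exists>R::real. \<forall>q\<in>ideal_boundary m. ereal R < boundary_prod m w p q \<longrightarrow> q \<in> U)"

definition boundary_topology :: "'x metric \<Rightarrow> (nat \<Rightarrow> 'x) set topology" where
  "boundary_topology m = topology (boundary_open m)"

lemma istopology_boundary_open: "istopology (boundary_open m)"
  unfolding istopology_def
proof (intro conjI allI impI)
  fix S T assume ST: "boundary_open m S" "boundary_open m T"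
  show "boundary_open m (S \<inter> T)"
    unfolding boundary_open_def
  proof (intro conjI ballI)
    show "S \<inter> T \<subseteq> ideal_boundary m" using ST by (auto simp: boundary_open_def)
    fix p w assume p: "p \<in> S \<inter> T" and w: "w \<in> mspace m"
    obtain R1 where R1: "\<And>q. q \<in> ideal_boundary m \<Longrightarrow> ereal R1 < boundary_prod m w p q \<Longrightarrow> q \<in> S"
      using ST(1) p w unfolding boundary_open_def by blast
    obtain R2 where R2: "\<And>q. q \<in> ideal_boundary m \<Longrightarrow> ereal R2 < boundary_prod m w p q \<Longrightarrow> q \<in> T"
      using ST(2) p w unfolding boundary_open_def by blast
    have "q \<in> S \<inter> T"
      if "q \<in> ideal_boundary m" and lt: "ereal (max R1 R2) < boundary_prod m w p q" for q
    proof -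
      have "ereal R1 < boundary_prod m w p q" "ereal R2 < boundary_prod m w p q"
        using lt by (auto intro: le_less_trans[rotated])
      then show ?thesis using R1 R2 that by blast
    qed
    then show "\<exists>R. \<forall>q\<in>ideal_boundary m. ereal R < boundary_prod m w p q \<longrightarrow> q \<in> S \<inter> T"
      by blast
  qed
next
  fix \<U> assume "\<forall>U\<in>\<U>. boundary_open m U"
  then show "boundary_open m (\<Union>\<U>)"
    unfolding boundary_open_def by (meson Union_iff Union_least)
qed

lemma openin_boundary_topology: "openin (boundary_topology m) = boundary_open m"
  by (simp add: boundary_topology_def istopology_boundary_open topology_inverse')

lemma topspace_boundary_topology [simp]: "topspace (boundary_topology m) = ideal_boundary m"
proof -
  have "boundary_open m (ideal_boundary m)" by (auto simp: boundary_open_def)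
  then show ?thesis
    by (auto simp: topspace_def openin_boundary_topology boundary_open_def)
qed

definition boundary_action ::
    "'x metric \<Rightarrow> ('a \<Rightarrow> 'x \<Rightarrow> 'x) \<Rightarrow> 'a \<Rightarrow> (nat \<Rightarrow> 'x) set \<Rightarrow> (nat \<Rightarrow> 'x) set" where
  "boundary_action m \<phi> g = (\<lambda>p\<in>ideal_boundary m. (\<lambda>s. \<phi> g \<circ> s) ` p)"


section \<open>Geometrically finite convergence groups\<close>

text \<open>
  Local uniform convergence on the complement of \<open>b\<close> to the constant map \<open>a\<close>, for a subsequence
  of any sequence of pairwise distinct group elements; \<open>a = b\<close> is allowed.
\<close>

definition convergence_action ::
    "('a, 'b) monoid_scheme \<Rightarrow> 'z topology \<Rightarrow> ('a \<Rightarrow> 'z \<Rightarrow> 'z) \<Rightarrow> bool" where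
  "convergence_action G T \<psi> \<longleftrightarrow>
     compact_space T \<and> Hausdorff_space T \<and> group_action G (topspace T) \<psi> \<and>
     (\<forall>g\<in>carrier G. homeomorphic_map T T (\<psi> g)) \<and>
     (\<forall>g::nat \<Rightarrow> 'a. range g \<subseteq> carrier G \<and> inj g \<longrightarrow>
        (\<exists>r a b. strict_mono (r :: nat \<Rightarrow> nat) \<and> a \<in> topspace T \<and> b \<in> topspace T \<and>
           (\<forall>K U. compactin T K \<and> b \<notin> K \<and> openin T U \<and> a \<in> U \<longrightarrow>
              (\<forall>\<^sub>F n in sequentially. \<psi> (g (r n)) ` K \<subseteq> U))))"

definition loxodromic ::
    "('a, 'b) monoid_scheme \<Rightarrow> 'z topology \<Rightarrow> ('a \<Rightarrow> 'z \<Rightarrow> 'z) \<Rightarrow> 'a \<Rightarrow> bool" where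
  "loxodromic G T \<psi> g \<longleftrightarrow>
     (\<forall>n::nat. 0 < n \<longrightarrow> g [^]\<^bsub>G\<^esub> n \<noteq> \<one>\<^bsub>G\<^esub>) \<and> card (invariants (topspace T) \<psi> g) = 2"

definition conical_limit_point ::
    "('a, 'b) monoid_scheme \<Rightarrow> 'z topology \<Rightarrow> ('a \<Rightarrow> 'z \<Rightarrow> 'z) \<Rightarrow> 'z \<Rightarrow> bool" where
  "conical_limit_point G T \<psi> p \<longleftrightarrow> p \<in> topspace T \<and>
     (\<exists>(g :: nat \<Rightarrow> 'a) a b. range g \<subseteq> carrier G \<and> a \<in> topspace T \<and> b \<in> topspace T \<and> a \<noteq> b \<and>
        limitin T (\<lambda>n. \<psi> (g n) p) a sequentially \<and>
        (\<forall>x\<in>topspace T - {p}. limitin T (\<lambda>n. \<psi> (g n) x) b sequentially))"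

definition bounded_parabolic_point ::
    "('a, 'b) monoid_scheme \<Rightarrow> 'z topology \<Rightarrow> ('a \<Rightarrow> 'z \<Rightarrow> 'z) \<Rightarrow> 'z \<Rightarrow> bool" where
  "bounded_parabolic_point G T \<psi> p \<longleftrightarrow> p \<in> topspace T \<and>
     infinite (stabilizer G \<psi> p) \<and>
     (\<forall>g\<in>stabilizer G \<psi> p. \<not> loxodromic G T \<psi> g) \<and>
     (\<exists>K. compactin T K \<and> K \<subseteq> topspace T - {p} \<and>
          (\<Union>g\<in>stabilizer G \<psi> p. \<psi> g ` K) = topspace T - {p})"

definition geometrically_finite ::
    "('a, 'b) monoid_scheme \<Rightarrow> 'z topology \<Rightarrow> ('a \<Rightarrow> 'z \<Rightarrow> 'z) \<Rightarrow> bool" where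
  "geometrically_finite G T \<psi> \<longleftrightarrow>
     (\<forall>p\<in>topspace T. conical_limit_point G T \<psi> p \<or> bounded_parabolic_point G T \<psi> p)"

definition maximal_parabolics ::
    "('a, 'b) monoid_scheme \<Rightarrow> 'z topology \<Rightarrow> ('a \<Rightarrow> 'z \<Rightarrow> 'z) \<Rightarrow> 'a set set" where
  "maximal_parabolics G T \<psi> = {stabilizer G \<psi> p | p. bounded_parabolic_point G T \<psi> p}"


section \<open>Relatively hyperbolic groups\<close>

definition isometric_action ::
    "('a, 'b) monoid_scheme \<Rightarrow> 'x metric \<Rightarrow> ('a \<Rightarrow> 'x \<Rightarrow> 'x) \<Rightarrow> bool" where
  "isometric_action G m \<phi> \<longleftrightarrow> group_action G (mspace m) \<phi> \<and>
     (\<forall>g\<in>carrier G. \<forall>x\<in>mspace m. \<forall>y\<in>mspace m. mdist m (\<phi> g x) (\<phi> g y) = mdist m x y)"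

definition properly_discontinuous ::
    "('a, 'b) monoid_scheme \<Rightarrow> 'x metric \<Rightarrow> ('a \<Rightarrow> 'x \<Rightarrow> 'x) \<Rightarrow> bool" where
  "properly_discontinuous G m \<phi> \<longleftrightarrow>
     (\<forall>K. compactin (mtopology_of m) K \<longrightarrow> finite {g\<in>carrier G. \<phi> g ` K \<inter> K \<noteq> {}})"

text \<open>The space must be nonempty: every group acts properly discontinuously on the empty space.\<close>

definition rel_hyp_action ::
    "('a, 'b) monoid_scheme \<Rightarrow> 'a set set \<Rightarrow> 'x metric \<Rightarrow> ('a \<Rightarrow> 'x \<Rightarrow> 'x) \<Rightarrow> bool" where
  "rel_hyp_action G \<P> m \<phi> \<longleftrightarrow>
     mspace m \<noteq> {} \<and> proper_metric m \<and> path_metric m \<and> gromov_hyperbolic m \<and>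
     isometric_action G m \<phi> \<and> properly_discontinuous G m \<phi> \<and>
     convergence_action G (boundary_topology m) (boundary_action m \<phi>) \<and>
     geometrically_finite G (boundary_topology m) (boundary_action m \<phi>) \<and>
     \<P> = maximal_parabolics G (boundary_topology m) (boundary_action m \<phi>)"

text \<open>
  The type \<open>real\<close> only supplies names for the points of the space; its own metric plays no role.
  This is no restriction: a proper metric space is separable, hence has at most continuum many
  points, and so is isometric to a metric on some set of reals.
\<close>

definition hyperbolic_relative_to :: "('a, 'b) monoid_scheme \<Rightarrow> 'a set set \<Rightarrow> bool" where
  "hyperbolic_relative_to G \<P> \<longleftrightarrow>
     fin_gen G (carrier G) \<and> (\<forall>H\<in>\<P>. subgroup H G \<and> fin_gen G H) \<and>
     (\<exists>(m :: real metric) \<phi>. rel_hyp_action G \<P> m \<phi>)"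

text \<open>
  As usual, the peripheral subgroups are proper.  Every infinite finitely generated group is
  hyperbolic relative to itself, acting on a combinatorial horoball, whose boundary is a single
  bounded parabolic point; without this convention the notion would be void.  Finite and
  two-ended groups are relatively hyperbolic, with \<open>\<P> = {}\<close>.
\<close>

definition relatively_hyperbolic :: "('a, 'b) monoid_scheme \<Rightarrow> bool" where
  "relatively_hyperbolic G \<longleftrightarrow> (\<exists>\<P>. hyperbolic_relative_to G \<P> \<and> carrier G \<notin> \<P>)"

end

theory Submission
  imports Defs "HOL-Library.Diagonal_Subsequence"
begin

text \<open>
  An automorphism that is not pointwise inner is detected, by conjugacy separability, in a finite
  quotient \<open>Q\<close> of \<open>G\<close>, hence by the action of \<open>Out(G)\<close> on the finite set of homomorphisms
  \<open>G \<rightarrow> Q\<close> modulo conjugation (Grossman).  It remains to see that a pointwise inner automorphism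
  \<open>\<alpha>\<close> has an inner power, for then its class is trivial in any torsion-free subgroup.

  Let \<open>S\<close> be a finite generating set.  As \<open>\<alpha>\<^sup>i(s)\<close> and \<open>\<alpha>\<^sup>i(s)\<alpha>\<^sup>i(t) = \<alpha>\<^sup>i(st)\<close> are conjugate to \<open>s\<close> and
  \<open>st\<close>, they move some point by at most a constant independent of \<open>i\<close>.  The coarse form of Serre's
  lemma on elliptic isometries of trees gives points \<open>x\<^sub>i\<close> that all of \<open>\<alpha>\<^sup>i(S)\<close> moves by at most \<open>C\<close>.
  After composing \<open>\<alpha>\<^sup>i\<close> with an inner automorphism, the base point is nearest to \<open>x\<^sub>i\<close> in its orbit up
  to an error of 1.  If infinitely many \<open>x\<^sub>i\<close> stay in a bounded set, proper discontinuity and the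
  pigeonhole principle make two of the modified powers equal.  Otherwise a subsequence converges to a
  boundary point \<open>\<xi>\<close>.  Since no orbit point is closer to \<open>x\<^sub>i\<close> than the base point, \<open>\<xi>\<close> is not a
  conical limit point unless the boundary has just two points; and an element moving \<open>x\<^sub>i\<close> by at
  most \<open>C\<close> fixes \<open>\<xi>\<close> once \<open>i\<close> is large.  Hence \<open>G\<close> fixes \<open>\<xi>\<close>, so that \<open>G\<close> is a peripheral subgroup or,
  in the two-point case, finite.
\<close>

section \<open>Almost fixed points in hyperbolic spaces\<close>

locale hyperbolic_metric =
  fixes m :: "'x metric" and \<delta> :: real
  assumes four_point: "\<lbrakk>w \<in> mspace m; x \<in> mspace m; y \<in> mspace m; z \<in> mspace m\<rbrakk>
    \<Longrightarrow> min (gromov_prod m w x y) (gromov_prod m w y z) - \<delta> \<le> gromov_prod m w x z"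
begin

abbreviation "M \<equiv> mspace m"
abbreviation "d \<equiv> mdist m"
abbreviation "gp \<equiv> gromov_prod m"

lemma gp_commute: "gp w x y = gp w y x"
  by (simp add: gromov_prod_def mdist_commute)

lemma gp_add_gp: "gp w x y + gp x w y = d w x"
  by (simp add: gromov_prod_def mdist_commute field_simps)

lemma gp_change_base: "\<lbrakk>w \<in> M; v \<in> M; x \<in> M; y \<in> M\<rbrakk> \<Longrightarrow> gp w x y \<le> gp v x y + d w v"
  using mdist_triangle[of x m v w] mdist_triangle[of y m v w]
  by (simp add: gromov_prod_def mdist_commute field_simps)

lemma gp_change_point: "\<lbrakk>w \<in> M; x \<in> M; x' \<in> M; y \<in> M\<rbrakk> \<Longrightarrow> gp w x y \<le> gp w x' y + d x x'"
  using mdist_triangle[of x' m x y] mdist_triangle[of x m x' w]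
  by (simp add: gromov_prod_def mdist_commute field_simps)

lemma gp_trans:
  assumes "w \<in> M" "x \<in> M" "y \<in> M" "z \<in> M" "r \<le> gp w x y" "r \<le> gp w y z"
  shows "r - \<delta> \<le> gp w x z"
  using four_point[OF assms(1-4)] assms(5,6) by linarith

lemma delta_nonneg: "w \<in> M \<Longrightarrow> 0 \<le> \<delta>"
  using four_point[of w w w w] by (simp add: gromov_prod_def)

text \<open>In a tree the midpoint of \<open>[w, sw]\<close> is the projection of \<open>w\<close> to the fixed set of \<open>s\<close>.
  It lies beyond the projection of \<open>w\<close> to the fixed set of \<open>t\<close> on a segment from \<open>w\<close> to a common
  fixed point \<open>q\<close>, and is therefore fixed by \<open>t\<close>.\<close>

lemma midpoint_almost_fixed:
  fixes s t :: "'x \<Rightarrow> 'x"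
  assumes M: "w \<in> M" "q \<in> M" "s w \<in> M" "s q \<in> M" "t w \<in> M" "t q \<in> M" "t p \<in> M" "p \<in> M"
    and s: "d (s w) (s q) = d w q"
    and t: "d (t w) (t q) = d w q" "d (t p) (t q) = d p q" "d (t w) (t p) = d w p"
    and E: "d q (s q) \<le> E" "d q (t q) \<le> E"
    and p: "d w p \<le> a + e" "d p (s w) \<le> a + e" "2 * a - e \<le> d w (s w)"
    and a: "d w (t w) \<le> 2 * a + e"
  shows "d p (t p) \<le> 5 * E + 12 * e + 8 * \<delta>"
proof -
  define h where "h = d w q"
  have \<delta>: "0 \<le> \<delta>" using delta_nonneg M by blast
  have e: "0 \<le> e"
    using p mdist_triangle[of w m p "s w"] M by linarith
  have sq: "d (s w) q \<le> h + E" "d (t w) q \<le> h + E" "h - E \<le> d (t w) q"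
    using mdist_triangle[of "s w" m "s q" q] mdist_triangle[of "t w" m "t q" q]
      mdist_triangle[of "t w" m q "t q"] M s t E by (auto simp: h_def mdist_commute)
  have wp: "a - 2 * e \<le> d w p" "a - 2 * e \<le> d p (s w)"
    using mdist_triangle[of w m p "s w"] p M by linarith+
  \<comment> \<open>\<open>p\<close> is nearly on a geodesic from \<open>w\<close> to
    \<open>s w\<close>, hence nearly on a side from \<open>q\<close> to \<open>w\<close> or to
    \<open>s w\<close>. Both sides give the same estimate, because \<open>s w\<close> is at most
    \<open>E\<close> farther from \<open>q\<close> than \<open>w\<close>.\<close>
  have "gp p w q \<le> 3 * e / 2 + \<delta> \<or> gp p q (s w) \<le> 3 * e / 2 + \<delta>"
  proof -
    have "gp p w (s w) \<le> 3 * e / 2"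
      using p by (simp add: gromov_prod_def mdist_commute field_simps)
    then show ?thesis using four_point[of p w q "s w"] M by linarith
  qed
  then have pq: "d p q \<le> h - a + E + 5 * e + 2 * \<delta>"
    using wp sq p E e M mdist_nonneg[of m q "s q"]
    by (auto simp: gromov_prod_def mdist_commute h_def field_simps)
  have pq': "h - a - e \<le> d p q"
    using mdist_triangle[of w m p q] M p by (simp add: h_def)
  have tp: "d (t p) q \<le> d p q + E" "d p q - E \<le> d (t p) q"
    using mdist_triangle[of "t p" m "t q" q] mdist_triangle[of "t p" m q "t q"] t E M
    by (auto simp: mdist_commute)
  \<comment> \<open>A lower bound for the products at \<open>q\<close> of consecutive points in the
    chain \<open>p\<close>, \<open>w\<close>, \<open>t w\<close>, \<open>t p\<close>; the last link
    dictates it. Two four-point inequalities carry it over to \<open>p\<close> and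
    \<open>t p\<close>, which are both about \<open>h - a\<close> away from
    \<open>q\<close>.\<close>
  define r where "r = h - a - E - e"
  have E0: "0 \<le> E" using E(1) mdist_nonneg[of m q "s q"] by linarith
  have 1: "r \<le> gp q p w"
    using pq' p E0 e by (simp add: gromov_prod_def mdist_commute r_def h_def field_simps)
  have 2: "r \<le> gp q w (t w)"
    using sq a E0 e by (simp add: gromov_prod_def mdist_commute r_def h_def field_simps)
  have 3: "r \<le> gp q (t w) (t p)"
    using sq tp pq' p t E0 e by (simp add: gromov_prod_def mdist_commute r_def h_def field_simps)
  have "r - \<delta> \<le> gp q p (t w)" using gp_trans[OF _ _ _ _ 1 2] M by blast
  moreover have "r - \<delta> \<le> gp q (t w) (t p)" using 3 \<delta> by linarith
  ultimately have "r - \<delta> - \<delta> \<le> gp q p (t p)" using gp_trans M by blast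
  then show ?thesis
    using pq tp e by (simp add: gromov_prod_def mdist_commute r_def field_simps)
qed

end

text \<open>A substitute for a point on a geodesic. A path of length below
  \<open>mdist m x y + e\<close> has, by the intermediate value theorem, a point at distance
  \<open>r\<close> from \<open>x\<close>; the polygon through \<open>x\<close>, this point and
  \<open>y\<close> is no longer than the path.\<close>

lemma path_metric_point_between:
  fixes m :: "'x metric"
  assumes "path_metric m" and M: "x \<in> mspace m" "y \<in> mspace m"
    and r: "0 \<le> r" "r \<le> mdist m x y" and e: "0 < e"
  obtains z where "z \<in> mspace m" "mdist m x z = r" "mdist m z y \<le> mdist m x y - r + e"
proof -
  have "(INF \<gamma> \<in> {\<gamma>. pathin (mtopology_of m) \<gamma> \<and> \<gamma> 0 = x \<and> \<gamma> 1 = y}. curve_length m \<gamma>)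
      < ereal (mdist m x y + e)"
  proof -
    have "ereal (mdist m x y) =
      (INF \<gamma> \<in> {\<gamma>. pathin (mtopology_of m) \<gamma> \<and> \<gamma> 0 = x \<and> \<gamma> 1 = y}. curve_length m \<gamma>)"
      using assms(1) M unfolding path_metric_def by blast
    then show ?thesis using e by (metis ereal_less_eq(3) less_add_same_cancel1 linorder_not_le)
  qed
  then obtain \<gamma> where \<gamma>: "pathin (mtopology_of m) \<gamma>" "\<gamma> 0 = x" "\<gamma> 1 = y"
    and len: "curve_length m \<gamma> < ereal (mdist m x y + e)"
    by (auto simp: INF_less_iff)
  have cont: "continuous_map (top_of_set {0..1}) (mtopology_of m) \<gamma>"
    using \<gamma>(1) by (simp add: pathin_def)
  have "continuous_map (top_of_set {0..1}) euclideanreal (\<lambda>t. mdist m x (\<gamma> t))"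
    using continuous_map_mdist[OF _ cont, of "\<lambda>_. x"] M by simp
  then have cont_d: "continuous_on {0..1} (\<lambda>t. mdist m x (\<gamma> t))" by simp
  have "mdist m x (\<gamma> 0) = 0" using M \<gamma>(2) by simp
  then have "mdist m x (\<gamma> 0) \<le> r" "r \<le> mdist m x (\<gamma> 1)"
    using r \<gamma>(3) by simp_all
  then obtain t where t: "0 \<le> t" "t \<le> 1" "mdist m x (\<gamma> t) = r"
    using IVT'[of "\<lambda>t. mdist m x (\<gamma> t)" 0 r 1] cont_d by auto
  have "\<gamma> t \<in> mspace m"
    using cont t by (auto simp: continuous_map_def Pi_iff)
  moreover have "mdist m (\<gamma> t) y \<le> mdist m x y - r + e"
  proof -
    define u where "u = (\<lambda>i::nat. if i = 0 then 0 else if i = 1 then t else 1)"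
    have "(2, u) \<in> {(n::nat, t::nat \<Rightarrow> real). mono_on {..n} t \<and> t ` {..n} \<subseteq> {0..1}}"
      using t by (auto simp: u_def mono_on_def)
    then have "ereal (\<Sum>i<2. mdist m (\<gamma> (u i)) (\<gamma> (u (Suc i)))) \<le> curve_length m \<gamma>"
      unfolding curve_length_def by (force intro: SUP_upper2)
    moreover have "(\<Sum>i<2::nat. mdist m (\<gamma> (u i)) (\<gamma> (u (Suc i)))) = r + mdist m (\<gamma> t) y"
      using t \<gamma> by (simp add: u_def numeral_2_eq_2)
    ultimately have "ereal (r + mdist m (\<gamma> t) y) < ereal (mdist m x y + e)"
      using len by (metis order_le_less_trans)
    then show ?thesis by simp
  qed
  ultimately show ?thesis using that t by blast
qed

section \<open>Gromov products on the ideal boundary\<close>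

context hyperbolic_metric
begin

abbreviation "bdry \<equiv> ideal_boundary m"

text \<open>A substitute for \<open>R \<le> boundary_prod m w p q\<close>, equivalent to it up to a multiple of \<open>\<delta>\<close>,
  that allows the four-point inequality to be applied to representatives.\<close>

definition prod_ge :: "'x \<Rightarrow> real \<Rightarrow> (nat \<Rightarrow> 'x) set \<Rightarrow> (nat \<Rightarrow> 'x) set \<Rightarrow> bool" where
  "prod_ge w R p q \<longleftrightarrow> (\<forall>s\<in>p. \<forall>t\<in>q. \<exists>N. \<forall>i\<ge>N. \<forall>j\<ge>N. R \<le> gp w (s i) (t j))"

text \<open>Gromov products at \<open>w\<close> and \<open>v\<close> differ by at most
  \<open>d w v\<close>, so a single base point decides divergence.\<close>

lemma diverge_together_iff:
  assumes "w \<in> M" "range s \<subseteq> M" "range t \<subseteq> M"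
  shows "diverge_together m s t \<longleftrightarrow> (\<forall>R. \<exists>N. \<forall>i\<ge>N. \<forall>j\<ge>N. R \<le> gp w (s i) (t j))"
proof -
  have iff: "filterlim (\<lambda>(i, j). gp v (s i) (t j)) at_top (sequentially \<times>\<^sub>F sequentially)
      \<longleftrightarrow> (\<forall>R. \<exists>N. \<forall>i\<ge>N. \<forall>j\<ge>N. R \<le> gp v (s i) (t j))" for v
    by (simp add: filterlim_at_top eventually_prod_sequentially) blast
  have "\<exists>N. \<forall>i\<ge>N. \<forall>j\<ge>N. R \<le> gp v (s i) (t j)"
    if far: "\<forall>R. \<exists>N. \<forall>i\<ge>N. \<forall>j\<ge>N. R \<le> gp w (s i) (t j)" and v: "v \<in> M" for v R
  proof -
    obtain N where N: "\<forall>i\<ge>N. \<forall>j\<ge>N. R + d w v \<le> gp w (s i) (t j)"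
      using far by blast
    have "gp w (s i) (t j) \<le> gp v (s i) (t j) + d w v" for i j
      using gp_change_base assms v by blast
    with N show ?thesis by (metis add_le_cancel_right order_trans)
  qed
  then show ?thesis
    unfolding diverge_together_def iff using assms(1) by blast
qed

text \<open>The four-point inequality is applied along \<open>s'\<close>, \<open>s\<close>,
  \<open>t\<close> and then \<open>t'\<close>; each change of representative costs one
  \<delta>.\<close>

lemma gp_transfer:
  assumes "w \<in> M" "range s \<subseteq> M" "range t \<subseteq> M" "range s' \<subseteq> M" "range t' \<subseteq> M"
    and "diverge_together m s' s" "diverge_together m t t'"
    and "\<exists>N. \<forall>i\<ge>N. \<forall>j\<ge>N. R \<le> gp w (s i) (t j)"
  shows "\<exists>N. \<forall>i\<ge>N. \<forall>j\<ge>N. R - 2 * \<delta> \<le> gp w (s' i) (t' j)"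
proof -
  obtain N1 where N1: "\<And>i j. i \<ge> N1 \<Longrightarrow> j \<ge> N1 \<Longrightarrow> R \<le> gp w (s i) (t j)"
    using assms by blast
  obtain N2 where N2: "\<And>i j. i \<ge> N2 \<Longrightarrow> j \<ge> N2 \<Longrightarrow> R \<le> gp w (s' i) (s j)"
    using assms diverge_together_iff by metis
  obtain N3 where N3: "\<And>i j. i \<ge> N3 \<Longrightarrow> j \<ge> N3 \<Longrightarrow> R \<le> gp w (t i) (t' j)"
    using assms diverge_together_iff by metis
  define N where "N = max N1 (max N2 N3)"
  have "R - 2 * \<delta> \<le> gp w (s' i) (t' j)" if "i \<ge> N" "j \<ge> N" for i j
  proof -
    have M: "s i \<in> M" "t j \<in> M" "s' i \<in> M" "t' j \<in> M" using assms by auto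
    have "R - \<delta> \<le> gp w (s' i) (t j)"
      using gp_trans[of w "s' i" "s i" "t j" R] M assms(1) N1[of i j] N2[of i i] that
      by (auto simp: N_def)
    moreover have "R - \<delta> \<le> gp w (t j) (t' j)"
      using N3[of j j] that delta_nonneg[OF assms(1)] by (auto simp: N_def)
    ultimately show ?thesis
      using gp_trans[of w "s' i" "t j" "t' j" "R - \<delta>"] M assms(1) by auto
  qed
  then show ?thesis by blast
qed

section \<open>Boundary points as classes of sequences\<close>

lemma diverge_together_sym:
  assumes "range s \<subseteq> M" "range t \<subseteq> M" and st: "diverge_together m s t"
  shows "diverge_together m t s"
proof -
  have w: "s 0 \<in> M" using assms by auto
  have "\<exists>N. \<forall>i\<ge>N. \<forall>j\<ge>N. R \<le> gp (s 0) (t i) (s j)" for R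
  proof -
    obtain N where N: "\<And>i j. i \<ge> N \<Longrightarrow> j \<ge> N \<Longrightarrow> R \<le> gp (s 0) (s i) (t j)"
      using st diverge_together_iff[OF w assms(1,2)] by blast
    then have "R \<le> gp (s 0) (t i) (s j)" if "i \<ge> N" "j \<ge> N" for i j
      using gp_commute that by simp
    then show ?thesis by blast
  qed
  then show ?thesis using diverge_together_iff[OF w assms(2,1)] by blast
qed

lemma diverge_together_trans:
  assumes "range s \<subseteq> M" "range t \<subseteq> M" "range u \<subseteq> M"
    and "diverge_together m s t" "diverge_together m t u"
  shows "diverge_together m s u"
proof -
  have w: "s 0 \<in> M" using assms by auto
  have "\<exists>N. \<forall>i\<ge>N. \<forall>j\<ge>N. R \<le> gp (s 0) (s i) (u j)" for R
  proof -
    obtain N1 where N1: "\<And>i j. i \<ge> N1 \<Longrightarrow> j \<ge> N1 \<Longrightarrow> R + \<delta> \<le> gp (s 0) (s i) (t j)"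
      using assms diverge_together_iff w by metis
    obtain N2 where N2: "\<And>i j. i \<ge> N2 \<Longrightarrow> j \<ge> N2 \<Longrightarrow> R + \<delta> \<le> gp (s 0) (t i) (u j)"
      using assms diverge_together_iff w by metis
    have "R \<le> gp (s 0) (s i) (u j)" if "i \<ge> max N1 N2" "j \<ge> max N1 N2" for i j
      using gp_trans[of "s 0" "s i" "t i" "u j" "R + \<delta>"] N1[of i i] N2[of i j] that w assms
      by (simp add: image_subset_iff)
    then show ?thesis by blast
  qed
  then show ?thesis using diverge_together_iff w assms by metis
qed

lemma equiv_boundary:
  "equiv (gromov_seqs m) {(s, t). s \<in> gromov_seqs m \<and> t \<in> gromov_seqs m \<and> diverge_together m s t}"
proof (rule equivI)
  show "trans {(s, t). s \<in> gromov_seqs m \<and> t \<in> gromov_seqs m \<and> diverge_together m s t}"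
    by (rule transI) (auto simp: gromov_seqs_def intro: diverge_together_trans)
  show "sym {(s, t). s \<in> gromov_seqs m \<and> t \<in> gromov_seqs m \<and> diverge_together m s t}"
    by (rule symI) (simp add: diverge_together_sym gromov_seqs_def)
qed (auto simp: refl_on_def gromov_seqs_def)

lemma boundary_diverge:
  assumes "p \<in> bdry" "s \<in> p" "t \<in> p"
  shows "diverge_together m s t"
  using assms quotient_eq_iff[OF equiv_boundary, of p p s t] by (simp add: ideal_boundary_def)

lemma boundary_subset: "p \<in> bdry \<Longrightarrow> s \<in> p \<Longrightarrow> s \<in> gromov_seqs m"
  using in_quotient_imp_subset[OF equiv_boundary] by (auto simp: ideal_boundary_def)

lemma boundary_range: "p \<in> bdry \<Longrightarrow> s \<in> p \<Longrightarrow> range s \<subseteq> M"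
  using boundary_subset by (auto simp: gromov_seqs_def)

lemma boundary_in_mspace: "p \<in> bdry \<Longrightarrow> s \<in> p \<Longrightarrow> s i \<in> M"
  using boundary_range by blast

lemma boundary_nonempty: "p \<in> bdry \<Longrightarrow> \<exists>s. s \<in> p"
  using in_quotient_imp_non_empty[OF equiv_boundary] by (auto simp: ideal_boundary_def)

lemma boundary_eqI:
  assumes "p \<in> bdry" "q \<in> bdry" "s \<in> p" "t \<in> q" "diverge_together m s t"
  shows "p = q"
  using assms quotient_eq_iff[OF equiv_boundary, of p q s t] boundary_subset[of p s]
    boundary_subset[of q t]
  by (simp add: ideal_boundary_def)

lemma gromov_seq_in_boundary:
  assumes "s \<in> gromov_seqs m"
  obtains p where "p \<in> bdry" "s \<in> p"
proof -
  let ?E = "{(s, t). s \<in> gromov_seqs m \<and> t \<in> gromov_seqs m \<and> diverge_together m s t}"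
  have "?E `` {s} \<in> bdry"
    unfolding ideal_boundary_def using assms by (rule quotientI)
  moreover have "s \<in> ?E `` {s}"
    using assms equiv_class_self[OF equiv_boundary] by blast
  ultimately show ?thesis using that by blast
qed

section \<open>Calculus of bounded Gromov products at infinity\<close>

lemma prod_ge_mono: "prod_ge w R p q \<Longrightarrow> R' \<le> R \<Longrightarrow> prod_ge w R' p q"
  unfolding prod_ge_def by (meson order_trans)

lemma prod_ge_sym: "prod_ge w R p q \<Longrightarrow> prod_ge w R q p"
  unfolding prod_ge_def by (subst gp_commute) blast

lemma prod_ge_refl: "w \<in> M \<Longrightarrow> p \<in> bdry \<Longrightarrow> prod_ge w R p p"
  unfolding prod_ge_def using boundary_diverge boundary_range diverge_together_iff by metis

lemma prod_ge_trans:
  assumes "w \<in> M" "p \<in> bdry" "q \<in> bdry" "r \<in> bdry" "prod_ge w R p q" "prod_ge w R q r"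
  shows "prod_ge w (R - \<delta>) p r"
  unfolding prod_ge_def
proof (intro ballI)
  fix s u assume su: "s \<in> p" "u \<in> r"
  obtain t where t: "t \<in> q" using boundary_nonempty assms by blast
  obtain N1 where N1: "\<And>i j. i \<ge> N1 \<Longrightarrow> j \<ge> N1 \<Longrightarrow> R \<le> gp w (s i) (t j)"
    using assms su t unfolding prod_ge_def by metis
  obtain N2 where N2: "\<And>i j. i \<ge> N2 \<Longrightarrow> j \<ge> N2 \<Longrightarrow> R \<le> gp w (t i) (u j)"
    using assms su t unfolding prod_ge_def by metis
  have "R - \<delta> \<le> gp w (s i) (u j)" if "i \<ge> max N1 N2" "j \<ge> max N1 N2" for i j
    using gp_trans[of w "s i" "t i" "u j" R] N1[of i i] N2[of i j] that su t assms
    by (simp add: boundary_in_mspace)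
  then show "\<exists>N. \<forall>i\<ge>N. \<forall>j\<ge>N. R - \<delta> \<le> gp w (s i) (u j)" by blast
qed

lemma prod_ge_change_base:
  assumes "w \<in> M" "v \<in> M" "p \<in> bdry" "q \<in> bdry" "prod_ge w R p q"
  shows "prod_ge v (R - d w v) p q"
  unfolding prod_ge_def
proof (intro ballI)
  fix s t assume st: "s \<in> p" "t \<in> q"
  obtain N where N: "\<And>i j. i \<ge> N \<Longrightarrow> j \<ge> N \<Longrightarrow> R \<le> gp w (s i) (t j)"
    using assms st unfolding prod_ge_def by metis
  have "R - d w v \<le> gp v (s i) (t j)" if "i \<ge> N" "j \<ge> N" for i j
    using N[OF that] gp_change_base[of w v "s i" "t j"] assms st
    by (simp add: boundary_in_mspace)
  then show "\<exists>N. \<forall>i\<ge>N. \<forall>j\<ge>N. R - d w v \<le> gp v (s i) (t j)" by blast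
qed

lemma prod_geI:
  assumes "w \<in> M" "p \<in> bdry" "q \<in> bdry" "s \<in> p" "t \<in> q"
    and "\<exists>N. \<forall>i\<ge>N. \<forall>j\<ge>N. R \<le> gp w (s i) (t j)"
  shows "prod_ge w (R - 2 * \<delta>) p q"
  unfolding prod_ge_def
proof (intro ballI)
  fix s' t' assume "s' \<in> p" "t' \<in> q"
  then show "\<exists>N. \<forall>i\<ge>N. \<forall>j\<ge>N. R - 2 * \<delta> \<le> gp w (s' i) (t' j)"
    using gp_transfer[of w s t s' t' R] assms boundary_range boundary_diverge by blast
qed

text \<open>The negated hypothesis only provides some representatives and some late indices; the
  conclusion holds for given representatives and all late indices. For if one late pair had a
  product of at least \<open>R + 4 * \<delta>\<close>, convergence of \<open>s\<close> and
  \<open>t\<close> to their classes would give all late pairs at least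
  \<open>R + 2 * \<delta>\<close>, and \<open>prod_geI\<close> would apply.\<close>

lemma not_prod_geD:
  assumes w: "w \<in> M" and pq: "p \<in> bdry" "q \<in> bdry" "s \<in> p" "t \<in> q" and "\<not> prod_ge w R p q"
  shows "\<exists>N. \<forall>i\<ge>N. \<forall>j\<ge>N. gp w (s i) (t j) < R + 4 * \<delta>"
proof -
  have M: "s i \<in> M" "t i \<in> M" for i using pq by (auto simp: boundary_in_mspace)
  have "prod_ge w (R + 4 * \<delta>) p p" "prod_ge w (R + 4 * \<delta>) q q"
    using prod_ge_refl w pq by blast+
  then obtain N1 N2 where "\<And>i j. i \<ge> N1 \<Longrightarrow> j \<ge> N1 \<Longrightarrow> R + 4 * \<delta> \<le> gp w (s i) (s j)"
    "\<And>i j. i \<ge> N2 \<Longrightarrow> j \<ge> N2 \<Longrightarrow> R + 4 * \<delta> \<le> gp w (t i) (t j)"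
    using pq unfolding prod_ge_def by metis
  then obtain N where N: "\<And>i j. i \<ge> N \<Longrightarrow> j \<ge> N \<Longrightarrow> R + 4 * \<delta> \<le> gp w (s i) (s j)"
    "\<And>i j. i \<ge> N \<Longrightarrow> j \<ge> N \<Longrightarrow> R + 4 * \<delta> \<le> gp w (t i) (t j)"
    using max.bounded_iff by metis
  have "gp w (s i) (t j) < R + 4 * \<delta>" if ij: "i \<ge> N" "j \<ge> N" for i j
  proof (rule ccontr)
    assume *: "\<not> gp w (s i) (t j) < R + 4 * \<delta>"
    have "R + 2 * \<delta> \<le> gp w (s k) (t l)" if kl: "k \<ge> N" "l \<ge> N" for k l
    proof -
      have "R + 4 * \<delta> - \<delta> \<le> gp w (s k) (t j)"
        using gp_trans[OF w _ _ _ N(1)[OF kl(1) ij(1)]] * M by simp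
      moreover have "R + 4 * \<delta> - \<delta> \<le> gp w (t j) (t l)"
        using N(2)[OF ij(2) kl(2)] delta_nonneg[OF w] by simp
      ultimately have "R + 4 * \<delta> - \<delta> - \<delta> \<le> gp w (s k) (t l)" using gp_trans[OF w] M by blast
      then show ?thesis by simp
    qed
    then have "prod_ge w (R + 2 * \<delta> - 2 * \<delta>) p q" using prod_geI[OF w pq] by blast
    then show False using assms by simp
  qed
  then show ?thesis by blast
qed

lemma ex_not_prod_ge:
  assumes "w \<in> M" "p \<in> bdry" "q \<in> bdry" "p \<noteq> q"
  obtains R where "\<not> prod_ge w R p q"
proof -
  obtain s t where st: "s \<in> p" "t \<in> q" using boundary_nonempty assms by blast
  then have "\<not> diverge_together m s t" using boundary_eqI assms by blast
  then have "\<exists>R. \<not> prod_ge w R p q"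
    using st diverge_together_iff[of w s t] assms boundary_range unfolding prod_ge_def by blast
  then show ?thesis using that by blast
qed

section \<open>Comparison with the boundary topology\<close>

lemma boundary_prod_gt:
  assumes "w \<in> M" "p \<in> bdry" "q \<in> bdry" "ereal R < boundary_prod m w p q"
  shows "prod_ge w (R - 2 * \<delta>) p q"
proof -
  obtain s t where st: "s \<in> p" "t \<in> q"
    and "ereal R < Liminf (sequentially \<times>\<^sub>F sequentially) (\<lambda>(i, j). ereal (gp w (s i) (t j)))"
    using assms(4) by (auto simp: boundary_prod_def less_SUP_iff)
  then have "eventually (\<lambda>(i, j). ereal R < ereal (gp w (s i) (t j))) (sequentially \<times>\<^sub>F sequentially)"
    by (auto dest!: less_LiminfD simp: case_prod_unfold)
  then have "\<exists>N. \<forall>i\<ge>N. \<forall>j\<ge>N. R \<le> gp w (s i) (t j)"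
    by (auto simp: eventually_prod_sequentially intro: less_imp_le)
  then show ?thesis using prod_geI assms st by blast
qed

lemma boundary_prod_ge:
  assumes "p \<in> bdry" "q \<in> bdry" "prod_ge w R p q"
  shows "ereal R \<le> boundary_prod m w p q"
proof -
  obtain s t where st: "s \<in> p" "t \<in> q" using boundary_nonempty assms by blast
  obtain N where "\<forall>i\<ge>N. \<forall>j\<ge>N. R \<le> gp w (s i) (t j)"
    using assms st unfolding prod_ge_def by metis
  then have "eventually (\<lambda>(i, j). ereal R \<le> ereal (gp w (s i) (t j))) (sequentially \<times>\<^sub>F sequentially)"
    by (auto simp: eventually_prod_sequentially)
  then have "ereal R \<le> Liminf (sequentially \<times>\<^sub>F sequentially) (\<lambda>(i, j). ereal (gp w (s i) (t j)))"
    by (intro Liminf_bounded) (simp add: case_prod_unfold)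
  also have "\<dots> \<le> boundary_prod m w p q"
    unfolding boundary_prod_def using st by (intro SUP_upper2[of "(s, t)"]) auto
  finally show ?thesis .
qed

lemma limitin_boundary_prod_ge:
  assumes o: "w \<in> M" and lim: "limitin (boundary_topology m) x a sequentially"
  shows "\<forall>\<^sub>F n in sequentially. x n \<in> bdry \<and> prod_ge w R a (x n)"
proof -
  \<comment> \<open>The set of \<open>z\<close> with \<open>prod_ge w R a z\<close> need not be
    open. \<open>U\<close> consists of the points that have a whole \<open>prod_ge\<close> ball
    inside it, and so serves as its interior.\<close>
  define U where "U = {q \<in> bdry. \<exists>r. \<forall>z\<in>bdry. prod_ge w r q z \<longrightarrow> prod_ge w R a z}"
  have "boundary_open m U"
    unfolding boundary_open_def
  proof (intro conjI ballI)
    fix q v assume q: "q \<in> U" and v: "v \<in> M"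
    then obtain r where r: "\<And>z. z \<in> bdry \<Longrightarrow> prod_ge w r q z \<Longrightarrow> prod_ge w R a z" and qb: "q \<in> bdry"
      unfolding U_def by blast
    \<comment> \<open>Of the \<open>3 * \<delta>\<close>, two are lost in passing from
      \<open>boundary_prod\<close> to \<open>prod_ge\<close> and one in
      \<open>prod_ge_trans\<close>; \<open>d v w\<close> pays for the change of base point.\<close>
    have "z \<in> U" if z: "z \<in> bdry" and "ereal (r + 3 * \<delta> + d v w) < boundary_prod m v q z" for z
    proof -
      have "prod_ge v (r + \<delta> + d v w) q z"
        using boundary_prod_gt[OF v qb that] by (simp add: algebra_simps)
      then have qz: "prod_ge w (r + \<delta>) q z"
        using prod_ge_change_base[OF v o qb z] by fastforce
      have "prod_ge w R a y" if "y \<in> bdry" "prod_ge w (r + \<delta>) z y" for y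
        using prod_ge_trans[OF o qb z that(1) qz that(2)] r that by simp
      then show "z \<in> U" using z unfolding U_def by blast
    qed
    then show "\<exists>R. \<forall>z\<in>bdry. ereal R < boundary_prod m v q z \<longrightarrow> z \<in> U" by blast
  qed (auto simp: U_def)
  moreover have "a \<in> U"
    using limitin_topspace[OF lim] by (auto simp: U_def)
  ultimately have "\<forall>\<^sub>F n in sequentially. x n \<in> U"
    using lim by (simp add: limitin_def openin_boundary_topology)
  then show ?thesis
    by (rule eventually_mono) (use o prod_ge_refl in \<open>auto simp: U_def\<close>)
qed

text \<open>In a Hausdorff space \<open>K\<close> is closed, so its complement is a neighbourhood of
  \<open>p\<close> and contains every point whose product with \<open>p\<close> is large.\<close>

lemma compact_avoiding_point_prod_bounded:
  assumes "w \<in> M" and H: "Hausdorff_space (boundary_topology m)"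
    and K: "compactin (boundary_topology m) K" and p: "p \<in> bdry" "p \<notin> K"
  obtains R where "\<And>q. q \<in> K \<Longrightarrow> \<not> prod_ge w R p q"
proof -
  have "closedin (boundary_topology m) K" using H K compactin_imp_closedin by blast
  then have "boundary_open m (bdry - K)" and sub: "K \<subseteq> bdry"
    by (auto simp: closedin_def openin_boundary_topology)
  then obtain R where R: "\<And>q. q \<in> bdry \<Longrightarrow> ereal R < boundary_prod m w p q \<Longrightarrow> q \<in> bdry - K"
    unfolding boundary_open_def using assms by blast
  \<comment> \<open>The extra 1 turns the weak inequality of \<open>boundary_prod_ge\<close> into
    the strict one that defines neighbourhoods.\<close>
  have "\<not> prod_ge w (R + 1) p q" if "q \<in> K" for q
  proof
    assume "prod_ge w (R + 1) p q"
    then have "ereal (R + 1) \<le> boundary_prod m w p q" using boundary_prod_ge p sub that by blast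
    then have "ereal R < boundary_prod m w p q" by (rule less_le_trans[rotated]) simp
    then show False using R sub that by blast
  qed
  then show ?thesis using that by blast
qed

text \<open>Sequential compactness at infinity. For each \<open>n\<close>, points at distance
  \<open>n\<close> from \<open>w\<close> on near-geodesics to the \<open>x i\<close> lie in a
  compact ball, so along a subsequence they cluster; the corresponding \<open>x i\<close> then have
  large pairwise products. A diagonal subsequence does this for all \<open>n\<close>.\<close>

lemma ex_gromov_subseq:
  assumes proper: "proper_metric m" and path: "path_metric m"
    and w: "w \<in> M" and x: "range x \<subseteq> M" and lim: "filterlim (\<lambda>n. d w (x n)) at_top sequentially"
  obtains r where "strict_mono (r :: nat \<Rightarrow> nat)" "x \<circ> r \<in> gromov_seqs m"
proof -
  \<comment> \<open>The 1 absorbs the errors of the near-geodesics and of the clustering;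
    \<open>2 * \<delta>\<close> comes from the chain \<open>?x i\<close>, \<open>?y i\<close>,
    \<open>?y j\<close>, \<open>?x j\<close> below.\<close>
  define P where "P = (\<lambda>(n::nat) (s::nat \<Rightarrow> nat). \<forall>i j. real n - 1 - 2 * \<delta> \<le> gp w (x (s i)) (x (s j)))"
  have xM: "x k \<in> M" for k using x by auto
  have "\<exists>r'. strict_mono r' \<and> P n (s \<circ> r')" if s: "strict_mono s" for n and s :: "nat \<Rightarrow> nat"
  proof -
    have "filterlim (\<lambda>i. d w (x (s i))) at_top sequentially"
      using filterlim_compose[OF lim filterlim_subseq[OF s]] .
    then have "\<forall>\<^sub>F i in sequentially. real n \<le> d w (x (s i))"
      unfolding filterlim_at_top by blast
    then obtain I where I: "\<And>i. i \<ge> I \<Longrightarrow> real n \<le> d w (x (s i))"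
      unfolding eventually_sequentially by blast
    have "\<exists>y. y \<in> M \<and> d w y = n \<and> d y (x (s (I + i))) \<le> d w (x (s (I + i))) - n + 1" for i
      by (rule path_metric_point_between[OF path w xM, of "real n" "s (I + i)" 1]) (use I in auto)
    then obtain y where y: "\<And>i. y i \<in> M" "\<And>i. d w (y i) = n"
      and yx: "\<And>i. d (y i) (x (s (I + i))) \<le> d w (x (s (I + i))) - n + 1"
      by metis
    have "compactin (mtopology_of m) (mcball_of m w n)"
      using proper w unfolding proper_metric_def by blast
    moreover have "range y \<subseteq> mcball_of m w n" using y w by auto
    ultimately obtain l r where r: "strict_mono r"
      and lim: "limitin (mtopology_of m) (y \<circ> r) l sequentially"
      using Metric_space.compactin_sequentially[OF Metric_space_mspace_mdist, of m]
      unfolding mtopology_of_def by metis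
    then obtain J where J: "\<And>i. i \<ge> J \<Longrightarrow> d (y (r i)) l < 1 / 2" and l: "l \<in> M"
      using Metric_space.limit_metric_sequentially[OF Metric_space_mspace_mdist, of m "y \<circ> r" l]
      unfolding mtopology_of_def by (metis comp_apply half_gt_zero zero_less_one)
    define r' where "r' = (\<lambda>i. I + r (J + i))"
    have "strict_mono r'" using r by (auto simp: r'_def strict_mono_def)
    moreover have "real n - 1 - 2 * \<delta> \<le> gp w (x (s (r' i))) (x (s (r' j)))" for i j
    proof -
      let ?y = "\<lambda>i. y (r (J + i))" and ?x = "\<lambda>i. x (s (r' i))"
      have M: "?x i \<in> M" for i using x by auto
      have 1: "real n - 1 \<le> gp w (?x i) (?y i)" for i
        using yx[of "r (J + i)"] y by (simp add: gromov_prod_def mdist_commute r'_def field_simps)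
      have "d (?y i) (?y j) \<le> 1"
        using J[of "J + i"] J[of "J + j"] mdist_triangle[of "?y i" m l "?y j"] y l
        by (simp add: mdist_commute)
      then have 2: "real n - 1 \<le> gp w (?y i) (?y j)"
        using y by (simp add: gromov_prod_def mdist_commute field_simps)
      have "real n - 1 - \<delta> \<le> gp w (?x i) (?y j)"
        using gp_trans[OF w M _ _ 1 2] y by blast
      moreover have "real n - 1 - \<delta> \<le> gp w (?y j) (?x j)"
        using 1[of j] delta_nonneg[OF w] by (simp add: gp_commute)
      ultimately show ?thesis using gp_trans[OF w M _ M] y by (smt (verit))
    qed
    ultimately show ?thesis unfolding P_def comp_def by blast
  qed
  then interpret subseqs P by unfold_locales
  have P_D: "real k - 1 - 2 * \<delta> \<le> gp w (x (s i)) (x (s j))" if "P k s" for k s i j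
    using that by (simp add: P_def)
  \<comment> \<open>\<open>P k\<close> quantifies over all indices and so passes to subsequences;
    the diagonal sequence from \<open>Suc k\<close> on is a subsequence of one satisfying
    it.\<close>
  have diag: "P k (diagseq \<circ> ((+) (Suc k)))" for k
    by (rule diagseq_holds) (simp add: P_def)
  have "\<exists>N. \<forall>i\<ge>N. \<forall>j\<ge>N. R \<le> gp w ((x \<circ> diagseq) i) ((x \<circ> diagseq) j)" for R
  proof -
    obtain k :: nat where k: "R + 1 + 2 * \<delta> \<le> real k" using real_arch_simple by blast
    have "R \<le> gp w (x (diagseq i)) (x (diagseq j))" if "i \<ge> Suc k" "j \<ge> Suc k" for i j
    proof -
      have "real k - 1 - 2 * \<delta> \<le> gp w (x (diagseq i)) (x (diagseq j))"
        using P_D[OF diag[of k], of "i - Suc k" "j - Suc k"] that by simp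
      then show ?thesis using k by linarith
    qed
    then show ?thesis unfolding comp_def by blast
  qed
  moreover have "range (x \<circ> diagseq) \<subseteq> M" using x by auto
  ultimately have "x \<circ> diagseq \<in> gromov_seqs m"
    using diverge_together_iff w by (simp add: gromov_seqs_def)
  then show ?thesis using subseq_diagseq that by blast
qed

end

section \<open>Isometric actions\<close>

locale hyperbolic_action = hyperbolic_metric m \<delta> for m :: "'x metric" and \<delta> +
  fixes G (structure) and \<phi>
  assumes isom: "isometric_action G m \<phi>"
begin

sublocale group_action G "mspace m" \<phi>
  using isom by (simp add: isometric_action_def)

sublocale group G
  using group_hom group_hom.axioms(1) by blast

lemma act_closed [simp]: "g \<in> carrier G \<Longrightarrow> x \<in> M \<Longrightarrow> \<phi> g x \<in> M"
  using element_image by blast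

lemma act_dist [simp]: "g \<in> carrier G \<Longrightarrow> x \<in> M \<Longrightarrow> y \<in> M \<Longrightarrow> d (\<phi> g x) (\<phi> g y) = d x y"
  using isom by (simp add: isometric_action_def)

lemma act_gp [simp]:
  "g \<in> carrier G \<Longrightarrow> w \<in> M \<Longrightarrow> x \<in> M \<Longrightarrow> y \<in> M \<Longrightarrow> gp (\<phi> g w) (\<phi> g x) (\<phi> g y) = gp w x y"
  by (simp add: gromov_prod_def)

lemma act_one [simp]: "x \<in> M \<Longrightarrow> \<phi> \<one> x = x"
  using id_eq_one by (metis restrict_apply')

lemma act_inv [simp]:
  assumes "g \<in> carrier G" "x \<in> M"
  shows "\<phi> (inv g) (\<phi> g x) = x" "\<phi> g (\<phi> (inv g) x) = x"
  using composition_rule[of x "inv g" g] composition_rule[of x g "inv g"] assms by simp_all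

lemma act_dist_inv: "g \<in> carrier G \<Longrightarrow> x \<in> M \<Longrightarrow> y \<in> M \<Longrightarrow> d (\<phi> g x) y = d x (\<phi> (inv g) y)"
  using act_dist[of "inv g" "\<phi> g x" y] by simp

lemma act_gp_inv:
  "g \<in> carrier G \<Longrightarrow> w \<in> M \<Longrightarrow> x \<in> M \<Longrightarrow> y \<in> M \<Longrightarrow> gp w (\<phi> g x) (\<phi> g y) = gp (\<phi> (inv g) w) x y"
  using act_gp[of g "\<phi> (inv g) w" x y] by simp

text \<open>If \<open>s\<close> and \<open>st\<close> are elliptic in a tree and \<open>t\<close> fixes \<open>w\<close>, then \<open>sw = stw\<close> and both \<open>s\<close> and
  \<open>st\<close> fix the midpoint of \<open>[w, sw]\<close>; hence so does \<open>t\<close>.\<close>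

lemma pair_almost_fixed:
  assumes path: "path_metric m" and st: "s \<in> carrier G" "t \<in> carrier G"
    and z: "z \<in> M" "d z (\<phi> s z) \<le> D" and w: "w \<in> M" "d w (\<phi> t w) \<le> D"
    and v: "v \<in> M" "d v (\<phi> (s \<otimes> t) v) \<le> D"
  defines "F \<equiv> 17 * D + 12 + 8 * \<delta>"
  obtains p where "p \<in> M" "d p (\<phi> s p) \<le> F" "d p (\<phi> t p) \<le> 2 * F"
proof -
  have D: "0 \<le> D" using order_trans[OF mdist_nonneg z(2)] .
  \<comment> \<open>Half the displacement, so that \<open>p\<close> below is an approximate midpoint
    of \<open>w\<close> and \<open>\<phi> s w\<close>.\<close>
  define a where "a = d w (\<phi> s w) / 2"
  obtain p where p: "p \<in> M" "d w p = a" "d p (\<phi> s w) \<le> 2 * a - a + 1"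
    using path_metric_point_between[OF path w(1), of "\<phi> s w" a 1] st w by (auto simp: a_def)
  have stw: "\<phi> (s \<otimes> t) w = \<phi> s (\<phi> t w)" "\<phi> (s \<otimes> t) p = \<phi> s (\<phi> t p)"
    using composition_rule st w p by auto
  have dst: "d (\<phi> s w) (\<phi> (s \<otimes> t) w) \<le> D"
    using st w by (simp add: stw)
  have "d p (\<phi> s p) \<le> 5 * D + 12 * (D + 1) + 8 * \<delta>"
    by (rule midpoint_almost_fixed[of w z "\<phi> s" "\<phi> s" p D a "D + 1"])
      (use st w z p D in \<open>auto simp: a_def\<close>)
  moreover have "d p (\<phi> (s \<otimes> t) p) \<le> 5 * D + 12 * (D + 1) + 8 * \<delta>"
  \<comment> \<open>Since \<open>t\<close> moves \<open>w\<close> by at most \<open>D\<close>, the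
    images of \<open>w\<close> under \<open>s\<close> and \<open>s \<otimes> t\<close> are
    \<open>D\<close>-close, and \<open>p\<close> is also an approximate midpoint for
    \<open>s \<otimes> t\<close>, with error \<open>D + 1\<close>.\<close>
  proof (rule midpoint_almost_fixed[of w v "\<phi> (s \<otimes> t)" "\<phi> (s \<otimes> t)" p D a "D + 1"])
    show "d p (\<phi> (s \<otimes> t) w) \<le> a + (D + 1)"
      using mdist_triangle[of p m "\<phi> s w" "\<phi> (s \<otimes> t) w"] dst p st w by simp
    show "2 * a - (D + 1) \<le> d w (\<phi> (s \<otimes> t) w)"
      using mdist_triangle[of w m "\<phi> (s \<otimes> t) w" "\<phi> s w"] dst st w by (simp add: a_def mdist_commute)
    show "d w (\<phi> (s \<otimes> t) w) \<le> 2 * a + (D + 1)"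
      using mdist_triangle[of w m "\<phi> s w" "\<phi> (s \<otimes> t) w"] dst st w by (simp add: a_def)
  qed (use st w v p D in auto)
  moreover have "d p (\<phi> t p) = d (\<phi> s p) (\<phi> (s \<otimes> t) p)" using st p by (simp add: stw)
  ultimately show ?thesis
    using that[of p] mdist_triangle[of "\<phi> s p" m p "\<phi> (s \<otimes> t) p"] p st
    by (simp add: F_def mdist_commute)
qed

text \<open>A coarse form of Serre's lemma: finitely many isometries of a tree have a common fixed point
  once they and their pairwise products are elliptic.\<close>

lemma common_almost_fixed:
  assumes path: "path_metric m" and S: "finite S" "S \<noteq> {}" "S \<subseteq> carrier G" and M: "M \<noteq> {}"
    and ell: "\<And>s. s \<in> S \<Longrightarrow> \<exists>y\<in>M. d y (\<phi> s y) \<le> D"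
    and ell2: "\<And>s t. s \<in> S \<Longrightarrow> t \<in> S \<Longrightarrow> \<exists>y\<in>M. d y (\<phi> (s \<otimes> t) y) \<le> D"
  obtains x where "x \<in> M" "\<And>s. s \<in> S \<Longrightarrow> d x (\<phi> s x) \<le> 170 * D + 132 + 88 * \<delta>"
proof -
  obtain w where w: "w \<in> M" using M by blast
  let ?f = "\<lambda>s. d w (\<phi> s w)"
  have "Max (?f ` S) \<in> ?f ` S" using S by simp
  \<comment> \<open>With \<open>s\<close> of maximal displacement at \<open>w\<close>, the midpoint
    for \<open>s\<close> lies beyond the projection of \<open>w\<close> to the fixed set of every
    other \<open>t\<close>. Hence \<open>p\<close> depends on \<open>s\<close> alone, while the
    common almost fixed point \<open>q\<close> below varies with \<open>t\<close>.\<close>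
  then obtain s where "s \<in> S" "?f s = Max (?f ` S)" by auto
  then have s: "s \<in> S" "\<And>t. t \<in> S \<Longrightarrow> d w (\<phi> t w) \<le> d w (\<phi> s w)"
    using S(1) by simp_all
  define a where "a = d w (\<phi> s w) / 2"
  have sG: "s \<in> carrier G" using s S by blast
  obtain p where p: "p \<in> M" "d w p = a" "d p (\<phi> s w) \<le> 2 * a - a + 1"
    using path_metric_point_between[OF path w, of "\<phi> s w" a 1] sG w by (auto simp: a_def)
  have "d p (\<phi> t p) \<le> 170 * D + 132 + 88 * \<delta>" if t: "t \<in> S" for t
  proof -
    have tG: "t \<in> carrier G" using t S by blast
    obtain q where q: "q \<in> M" "d q (\<phi> s q) \<le> 17 * D + 12 + 8 * \<delta>"
      "d q (\<phi> t q) \<le> 2 * (17 * D + 12 + 8 * \<delta>)"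
      using pair_almost_fixed[OF path sG tG] ell[OF s(1)] ell[OF t] ell2[OF s(1) t] by metis
    then have "d q (\<phi> s q) \<le> 2 * (17 * D + 12 + 8 * \<delta>)"
      using order_trans[OF mdist_nonneg q(2)] by simp
    then have "d p (\<phi> t p) \<le> 5 * (2 * (17 * D + 12 + 8 * \<delta>)) + 12 * 1 + 8 * \<delta>"
      by (intro midpoint_almost_fixed[of w q "\<phi> s" "\<phi> t" p _ a 1])
        (use q p w add_increasing2[OF zero_le_one s(2)[OF t]] sG tG in \<open>simp_all add: a_def\<close>)
    then show ?thesis by simp
  qed
  then show ?thesis using that p by blast
qed

abbreviation "\<psi> \<equiv> boundary_action m \<phi>"

lemma boundary_action_mem: "p \<in> bdry \<Longrightarrow> s \<in> p \<Longrightarrow> \<phi> g \<circ> s \<in> \<psi> g p"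
  by (simp add: boundary_action_def)

lemma prod_ge_act:
  assumes "g \<in> carrier G" "w \<in> M" "p \<in> bdry" "q \<in> bdry"
  shows "prod_ge w R (\<psi> g p) (\<psi> g q) \<longleftrightarrow> prod_ge (\<phi> (inv g) w) R p q"
  using assms by (simp add: prod_ge_def boundary_action_def act_gp_inv boundary_in_mspace)

end

section \<open>Sequences far from an orbit\<close>

text \<open>The last assumption says that \<open>x\<close> runs to \<open>\<xi>\<close> inside a horoball that avoids the orbit of \<open>b\<close>.\<close>

locale horospherical = hyperbolic_action m \<delta> G \<phi>
  for m :: "'x metric" and \<delta> and G (structure) and \<phi> +
  fixes b :: 'x and x :: "nat \<Rightarrow> 'x" and \<xi> :: "(nat \<Rightarrow> 'x) set"
  assumes conv: "convergence_action G (boundary_topology m) (boundary_action m \<phi>)"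
    and b: "b \<in> mspace m"
    and \<xi>: "\<xi> \<in> ideal_boundary m" "x \<in> \<xi>"
    and near: "\<And>j g. g \<in> carrier G \<Longrightarrow> mdist m (x j) b \<le> mdist m (x j) (\<phi> g b) + 1"
begin

lemma boundary_group_action: "group_action G bdry \<psi>"
  using conv by (simp add: convergence_action_def)

lemma boundary_action_closed [simp]: "g \<in> carrier G \<Longrightarrow> p \<in> bdry \<Longrightarrow> \<psi> g p \<in> bdry"
  using group_action.element_image[OF boundary_group_action] by blast

lemma xM [simp]: "x j \<in> M"
  using boundary_in_mspace \<xi> by blast

text \<open>As \<open>x j\<close> is hardly closer to \<open>\<phi> g b\<close> than to
  \<open>b\<close>, geodesics from \<open>\<phi> g b\<close> to \<open>b\<close> and to
  \<open>x j\<close> run together for about half of the way to \<open>b\<close>.\<close>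

lemma orbit_not_deep:
  assumes "g \<in> carrier G"
  shows "d b (\<phi> g b) \<le> 2 * gp (\<phi> g b) b (x j) + 1"
  using near[OF assms, of j] by (simp add: gromov_prod_def mdist_commute field_simps)

text \<open>If \<open>t\<close> moves \<open>\<xi>\<close>, some translate \<open>v\<close> of \<open>b\<close> is near the geodesic from \<open>\<xi>\<close> to \<open>t\<xi>\<close>, hence near a
  geodesic from \<open>x\<^sub>i\<close> to \<open>\<xi>\<close> or to \<open>t\<xi>\<close>.  As \<open>v\<close> is no closer to the points of \<open>x\<close> than \<open>b\<close>, this bounds
  the Gromov products \<open>(x\<^sub>i | x\<^sub>j)\<^sub>b\<close>.\<close>

lemma small_displacement_fixes:
  assumes cocompact: "\<And>\<zeta>. \<zeta> \<in> bdry \<Longrightarrow> \<zeta> \<noteq> \<xi> \<Longrightarrow>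
      \<exists>p\<in>carrier G. \<psi> p \<xi> = \<xi> \<and> \<not> prod_ge b R \<xi> (\<psi> p \<zeta>)"
  shows "\<exists>N. \<forall>i\<ge>N. \<forall>t\<in>carrier G. d (x i) (\<phi> t (x i)) \<le> C \<longrightarrow> \<psi> t \<xi> = \<xi>"
proof -
  \<comment> \<open>Here \<open>4 * \<delta>\<close> is lost in \<open>not_prod_geD\<close>, one
    \<delta> in the four-point inequality, \<open>C\<close> in replacing \<open>x i\<close> by its
    translate, and 1 in \<open>gp_near\<close>. The absolute value covers the case below in which
    the displacement does not enter.\<close>
  have "prod_ge b (R + 5 * \<delta> + \<bar>C\<bar> + 1) \<xi> \<xi>" using prod_ge_refl b \<xi> by blast
  then obtain N where N: "\<And>i j. i \<ge> N \<Longrightarrow> j \<ge> N \<Longrightarrow> R + 5 * \<delta> + \<bar>C\<bar> + 1 \<le> gp b (x i) (x j)"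
    using \<xi> unfolding prod_ge_def by metis
  have gp_near: "gp b (x i) (x j) \<le> gp (\<phi> g b) (x i) (x j) + 1" if "g \<in> carrier G" for g i j
    using near[OF that, of i] near[OF that, of j] by (simp add: gromov_prod_def field_simps)
  have "\<psi> t \<xi> = \<xi>" if i: "i \<ge> N" and t: "t \<in> carrier G" and C: "d (x i) (\<phi> t (x i)) \<le> C" for i t
  proof (rule ccontr)
    assume "\<psi> t \<xi> \<noteq> \<xi>"
    then obtain p where p: "p \<in> carrier G" "\<psi> p \<xi> = \<xi>" "\<not> prod_ge b R \<xi> (\<psi> p (\<psi> t \<xi>))"
      using cocompact[of "\<psi> t \<xi>"] t \<xi> by auto
    have mem: "\<phi> p \<circ> x \<in> \<xi>" "\<phi> p \<circ> (\<phi> t \<circ> x) \<in> \<psi> p (\<psi> t \<xi>)"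
      using boundary_action_mem \<xi> p t by (metis, metis boundary_action_closed)
    then obtain N' where N': "\<forall>j\<ge>N'. \<forall>k\<ge>N'. gp b ((\<phi> p \<circ> x) j) ((\<phi> p \<circ> (\<phi> t \<circ> x)) k) < R + 4 * \<delta>"
      using not_prod_geD[OF b \<xi>(1) _ mem p(3)] boundary_action_closed p(1) t \<xi>(1) by metis
    define j where "j = max N N'"
    define v where "v = \<phi> (inv p) b"
    have v: "v \<in> M" using b p by (simp add: v_def)
    have "gp b (\<phi> p (x j)) (\<phi> p (\<phi> t (x j))) < R + 4 * \<delta>"
      using N' by (simp add: j_def)
    then have "gp v (x j) (\<phi> t (x j)) < R + 4 * \<delta>"
      using act_gp_inv[OF p(1) b] t by (simp add: v_def)
    then have "gp v (x j) (x i) < R + 5 * \<delta> \<or> gp v (x i) (\<phi> t (x j)) < R + 5 * \<delta>"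
      using four_point[of v "x j" "x i" "\<phi> t (x j)"] v t by auto
    then show False
    proof
      assume "gp v (x j) (x i) < R + 5 * \<delta>"
      then show False
        using gp_near[of "inv p" j i] N[of j i] i p by (simp add: v_def j_def)
    next
      assume "gp v (x i) (\<phi> t (x j)) < R + 5 * \<delta>"
      \<comment> \<open>Replacing \<open>x i\<close> by its translate lets \<open>inv t\<close> be
        applied to all three points; the product is then one of points of \<open>x\<close>, seen
        from another orbit point of \<open>b\<close>.\<close>
      then have "gp v (\<phi> t (x i)) (\<phi> t (x j)) < R + 5 * \<delta> + C"
        using gp_change_point[of v "\<phi> t (x i)" "x i" "\<phi> t (x j)"] C v t by (simp add: mdist_commute)
      then have "gp (\<phi> (inv t \<otimes> inv p) b) (x i) (x j) < R + 5 * \<delta> + C"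
        using act_gp_inv[OF t v] composition_rule[OF b, of "inv t" "inv p"] t p by (simp add: v_def)
      then show False
        using gp_near[of "inv t \<otimes> inv p" i j] N[of i j] i t p by (simp add: j_def)
    qed
  qed
  then show ?thesis by blast
qed

text \<open>With \<open>y = g\<^sub>n\<^sup>-\<^sup>1 b\<close>, the products \<open>(\<xi> | \<eta>)\<^sub>y\<close> and \<open>(\<xi> | \<zeta>)\<^sub>y\<close> stay bounded while \<open>(\<eta> | \<zeta>)\<^sub>y\<close> tends to
  infinity, so the orbit points \<open>y\<close> tend to \<open>\<xi>\<close> along a geodesic from \<open>b\<close>.\<close>

lemma no_conical_limit_point:
  assumes con: "conical_limit_point G (boundary_topology m) \<psi> \<xi>"
    and \<eta>: "\<eta> \<in> bdry" "\<eta> \<noteq> \<xi>" and \<zeta>: "\<zeta> \<in> bdry" "\<zeta> \<noteq> \<xi>" "\<zeta> \<noteq> \<eta>"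
  shows False
proof -
  obtain g u v where g: "range g \<subseteq> carrier G" and uv: "u \<in> bdry" "v \<in> bdry" "u \<noteq> v"
    and lim: "limitin (boundary_topology m) (\<lambda>n. \<psi> (g n) \<xi>) u sequentially"
      "\<And>z. z \<in> bdry - {\<xi>} \<Longrightarrow> limitin (boundary_topology m) (\<lambda>n. \<psi> (g n) z) v sequentially"
    using con unfolding conical_limit_point_def topspace_boundary_topology by blast
  have \<delta>: "0 \<le> \<delta>" using delta_nonneg b by blast
  obtain R0 where R0: "\<not> prod_ge b R0 u v" using ex_not_prod_ge b uv by blast
  obtain R1 where R1: "\<not> prod_ge b R1 \<eta> \<zeta>" using ex_not_prod_ge b \<eta> \<zeta> by metis
  \<comment> \<open>\<open>Q\<close> leaves room for two uses of \<open>prod_ge_trans\<close> before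
    \<open>R0\<close> is reached. \<open>A\<close> adds the losses of \<open>not_prod_geD\<close>
    and one four-point inequality, \<open>W\<close> will bound \<open>d b y\<close>, and
    \<open>L\<close> is still enough after the base point is moved by \<open>W\<close>.\<close>
  define Q where "Q = R0 + 2 * \<delta>"
  define A where "A = Q + 5 * \<delta>"
  define W where "W = max (2 * A + 1) (A + 5 * \<delta> + R1)"
  define L where "L = max Q (R1 + \<delta> + W)"
  have "\<forall>\<^sub>F n in sequentially. prod_ge b Q u (\<psi> (g n) \<xi>) \<and> prod_ge b L v (\<psi> (g n) \<eta>)
      \<and> prod_ge b L v (\<psi> (g n) \<zeta>)"
    using limitin_boundary_prod_ge[OF b lim(1), of Q] limitin_boundary_prod_ge[OF b lim(2), of \<eta> L]
      limitin_boundary_prod_ge[OF b lim(2), of \<zeta> L] \<eta> \<zeta>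
    by (auto simp: eventually_conj_iff)
  from eventually_happens'[OF sequentially_bot this]
  obtain n where n: "prod_ge b Q u (\<psi> (g n) \<xi>)" "prod_ge b L v (\<psi> (g n) \<eta>)"
      "prod_ge b L v (\<psi> (g n) \<zeta>)"
    by blast
  define h where "h = inv (g n)"
  define y where "y = \<phi> h b"
  have gn: "g n \<in> carrier G" using g by blast
  then have h: "h \<in> carrier G" and y: "y \<in> M" using b by (auto simp: h_def y_def)
  \<comment> \<open>If \<xi> and \<theta> were close seen from \<open>y\<close>, their images under
    \<open>g n\<close> would be close seen from \<open>b\<close>, and with them the distinct limits
    \<open>u\<close> and \<open>v\<close>.\<close>
  have escape: "\<not> prod_ge y Q \<xi> \<theta>" if "prod_ge b L v (\<psi> (g n) \<theta>)" "\<theta> \<in> bdry" for \<theta>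
  proof
    assume "prod_ge y Q \<xi> \<theta>"
    then have "prod_ge b Q (\<psi> (g n) \<xi>) (\<psi> (g n) \<theta>)"
      using prod_ge_act gn b \<xi> that by (simp add: y_def h_def)
    then have "prod_ge b (Q - \<delta>) u (\<psi> (g n) \<theta>)"
      using prod_ge_trans[OF b uv(1) _ _ n(1)] gn \<xi> that by simp
    moreover have "prod_ge b (Q - \<delta>) (\<psi> (g n) \<theta>) v"
      using prod_ge_sym[OF that(1)] by (rule prod_ge_mono) (use \<delta> in \<open>simp add: L_def\<close>)
    ultimately have "prod_ge b (Q - \<delta> - \<delta>) u v"
      using prod_ge_trans[OF b uv(1) boundary_action_closed[OF gn that(2)] uv(2)] by blast
    then show False using R0 by (simp add: Q_def)
  qed
  \<comment> \<open>Seen from a far \<open>y\<close>, the points \<open>b\<close> and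
    \<open>x k\<close> have a product above \<open>A\<close> by \<open>orbit_not_deep\<close>, but
    \<open>x k\<close> and \<open>s k\<close> do not. So \<open>b\<close> and \<open>s k\<close>
    have a product of at most \<open>A\<close> at \<open>y\<close>: a geodesic from \<open>b\<close>
    to \<open>s k\<close> passes near \<open>y\<close>.\<close>
  have towards: "\<forall>N. \<exists>k\<ge>N. d b y - A \<le> gp b y (s k)"
    if far: "2 * A + 1 < d b y" and \<theta>: "\<theta> \<in> bdry" "s \<in> \<theta>" and esc: "\<not> prod_ge y Q \<xi> \<theta>" for \<theta> s
  proof
    fix N
    obtain N' where N': "\<And>j k. j \<ge> N' \<Longrightarrow> k \<ge> N' \<Longrightarrow> gp y (x j) (s k) < Q + 4 * \<delta>"
      using not_prod_geD[OF y \<xi>(1) \<theta>(1) \<xi>(2) \<theta>(2) esc] by blast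
    define k where "k = max N N'"
    have sk: "s k \<in> M" using boundary_in_mspace \<theta> by blast
    have "A < gp y (x k) b"
      using orbit_not_deep[OF h, of k] far by (simp add: gp_commute y_def)
    then have "gp y b (s k) \<le> A"
      using four_point[of y "x k" b "s k"] N'[of k k] y b sk by (simp add: A_def k_def)
    then show "\<exists>k\<ge>N. d b y - A \<le> gp b y (s k)"
      using gp_add_gp[of b y "s k"] by (intro exI[of _ k]) (simp add: k_def)
  qed
  obtain s t where st: "s \<in> \<eta>" "t \<in> \<zeta>" using boundary_nonempty \<eta> \<zeta> by blast
  \<comment> \<open>Otherwise \<open>y\<close> would be nearly on the way from \<open>b\<close> to
    both \<eta> and \<zeta>, beyond the place where these directions part.\<close>
  have "d b y \<le> W"
  proof (cases "2 * A + 1 < d b y")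
    case True
    obtain N where N: "\<And>k l. k \<ge> N \<Longrightarrow> l \<ge> N \<Longrightarrow> gp b (s k) (t l) < R1 + 4 * \<delta>"
      using not_prod_geD[OF b \<eta>(1) \<zeta>(1) st R1] by blast
    obtain k where k: "k \<ge> N" "d b y - A \<le> gp b y (s k)"
      using towards[OF True \<eta>(1) st(1) escape[OF n(2) \<eta>(1)]] by blast
    obtain l where l: "l \<ge> N" "d b y - A \<le> gp b y (t l)"
      using towards[OF True \<zeta>(1) st(2) escape[OF n(3) \<zeta>(1)]] by blast
    have "d b y - A - \<delta> \<le> gp b (s k) (t l)"
      using gp_trans[of b "s k" y "t l"] b y st k l \<eta> \<zeta> by (simp add: gp_commute boundary_in_mspace)
    then show ?thesis using N[OF k(1) l(1)] by (simp add: W_def)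
  qed (simp add: W_def)
  \<comment> \<open>Both images are close to \<open>v\<close>; translated back, \<eta> and \<zeta>
    are close seen from \<open>y\<close>, and by the bound on \<open>d b y\<close> also seen from
    \<open>b\<close>.\<close>
  have "prod_ge b (L - \<delta>) (\<psi> (g n) \<eta>) (\<psi> (g n) \<zeta>)"
    using prod_ge_trans[OF b _ uv(2) _ prod_ge_sym[OF n(2)] n(3)] gn \<eta> \<zeta> by simp
  then have "prod_ge y (L - \<delta>) \<eta> \<zeta>"
    using prod_ge_act gn b \<eta> \<zeta> by (simp add: y_def h_def)
  then have "prod_ge b (L - \<delta> - d y b) \<eta> \<zeta>"
    using prod_ge_change_base y b \<eta> \<zeta> by blast
  then have "prod_ge b R1 \<eta> \<zeta>"
    by (rule prod_ge_mono) (use \<open>d b y \<le> W\<close> in \<open>simp add: L_def mdist_commute\<close>)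
  then show False using R1 by blast
qed

text \<open>Every orbit point is near the line from \<xi> to \<eta>, because the group fixes both
  ends. Seen from a far orbit point, \<open>b\<close> lies on the side of \<xi>. This applies to
  \<open>g\<close> and, after translation, to \<open>inv g\<close>: each of \<open>b\<close> and
  \<open>\<phi> g b\<close> would lie on the \<xi> side of the other.\<close>

lemma fixed_pair_bounded_orbit:
  assumes \<eta>: "\<eta> \<in> bdry" "\<eta> \<noteq> \<xi>"
    and fixed: "\<And>g. g \<in> carrier G \<Longrightarrow> \<psi> g \<xi> = \<xi>" "\<And>g. g \<in> carrier G \<Longrightarrow> \<psi> g \<eta> = \<eta>"
  obtains B where "\<And>g. g \<in> carrier G \<Longrightarrow> d b (\<phi> g b) \<le> B"
proof -
  obtain R where R: "\<not> prod_ge b R \<xi> \<eta>" using ex_not_prod_ge b \<eta> \<xi> by metis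
  define A where "A = R + 5 * \<delta>"
  have towards: "\<exists>N. \<forall>k\<ge>N. gp (\<phi> g b) b (s k) \<le> A"
    if far: "2 * A + 1 < d b (\<phi> g b)" and g: "g \<in> carrier G" and s: "s \<in> \<eta>" for g s
  proof -
    have gb: "\<phi> g b \<in> M" using g b by simp
    have "\<not> prod_ge (\<phi> g b) R \<xi> \<eta>"
      using prod_ge_act[of "inv g" b \<xi> \<eta> R] R g b \<xi> \<eta> by (simp add: fixed)
    then obtain N where N: "\<And>j k. j \<ge> N \<Longrightarrow> k \<ge> N \<Longrightarrow> gp (\<phi> g b) (x j) (s k) < R + 4 * \<delta>"
      using not_prod_geD[OF gb \<xi>(1) \<eta>(1) \<xi>(2) s] by blast
    have "gp (\<phi> g b) b (s k) \<le> A" if "k \<ge> N" for k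
    proof -
      have "A < gp (\<phi> g b) (x k) b"
        using orbit_not_deep[OF g, of k] far by (simp add: gp_commute)
      then show ?thesis
        using four_point[of "\<phi> g b" "x k" b "s k"] N[of k k] that gb b s \<eta>
        by (simp add: A_def boundary_in_mspace)
    qed
    then show ?thesis by blast
  qed
  obtain s where s: "s \<in> \<eta>" using boundary_nonempty \<eta> by blast
  have "d b (\<phi> g b) \<le> max (2 * A) (2 * A + 1)" if g: "g \<in> carrier G" for g
  proof (cases "2 * A + 1 < d b (\<phi> g b)")
    case True
    \<comment> \<open>The translated sequence is used for \<open>g\<close> and \<open>s\<close>
      itself for \<open>inv g\<close>, so that after translation by \<open>g\<close> both bounds
      concern the same point \<open>\<phi> g (s k)\<close> and add up to
      \<open>d b (\<phi> g b)\<close>.\<close>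
    have "\<phi> g \<circ> s \<in> \<eta>" using boundary_action_mem[OF \<eta>(1) s, of g] fixed g by simp
    then obtain N1 where N1: "\<forall>k\<ge>N1. gp (\<phi> g b) b ((\<phi> g \<circ> s) k) \<le> A"
      using towards True g by blast
    have "2 * A + 1 < d b (\<phi> (inv g) b)"
      using True act_dist_inv[OF g b b] by (simp add: mdist_commute)
    then obtain N2 where N2: "\<forall>k\<ge>N2. gp (\<phi> (inv g) b) b (s k) \<le> A"
      using towards[of "inv g" s] s g by auto
    define k where "k = max N1 N2"
    have sk: "s k \<in> M" using boundary_in_mspace s \<eta> by blast
    have "gp b (\<phi> g b) (\<phi> g (s k)) \<le> A"
      using N2 act_gp_inv[OF g b b sk] by (simp add: k_def)
    moreover have "gp (\<phi> g b) b (\<phi> g (s k)) \<le> A" using N1 by (simp add: k_def)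
    ultimately show ?thesis using gp_add_gp[of b "\<phi> g b" "\<phi> g (s k)"] by simp
  qed simp
  then show ?thesis using that by blast
qed

end

section \<open>Parabolic or conical limit of the almost fixed points\<close>

context hyperbolic_action
begin

lemma finite_or_parabolic:
  assumes proper: "proper_metric m" and path: "path_metric m"
    and disc: "properly_discontinuous G m \<phi>"
    and conv: "convergence_action G (boundary_topology m) \<psi>"
    and gf: "geometrically_finite G (boundary_topology m) \<psi>"
    and b: "b \<in> M" and x: "range x \<subseteq> M"
    and near: "\<And>j g. g \<in> carrier G \<Longrightarrow> d (x j) b \<le> d (x j) (\<phi> g b) + 1"
    and lim: "filterlim (\<lambda>n. d b (x n)) at_top sequentially"
    and gen: "\<And>j. T j \<subseteq> carrier G" "\<And>j. generate G (T j) = carrier G"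
    and displ: "\<And>j t. t \<in> T j \<Longrightarrow> d (x j) (\<phi> t (x j)) \<le> C"
  shows "finite (carrier G) \<or> carrier G \<in> maximal_parabolics G (boundary_topology m) \<psi>"
proof -
  obtain r where r: "strict_mono r" "x \<circ> r \<in> gromov_seqs m"
    by (rule ex_gromov_subseq[OF proper path b x lim])
  then obtain \<xi> where \<xi>: "\<xi> \<in> bdry" "x \<circ> r \<in> \<xi>" using gromov_seq_in_boundary by blast
  interpret horospherical m \<delta> G \<phi> b "x \<circ> r" \<xi>
    by unfold_locales (use conv b \<xi> near in auto)
  interpret bd: group_action G bdry \<psi> by (rule boundary_group_action)
  have stab: "stabilizer G \<psi> \<xi> = carrier G"
    if coc: "\<And>\<zeta>. \<zeta> \<in> bdry \<Longrightarrow> \<zeta> \<noteq> \<xi> \<Longrightarrow> \<exists>p\<in>carrier G. \<psi> p \<xi> = \<xi> \<and> \<not> prod_ge b R \<xi> (\<psi> p \<zeta>)" for R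
  proof -
    \<comment> \<open>The generating set varies with the index, but a single index past the
      threshold puts generators of the whole group into the stabilizer.\<close>
    obtain N where N: "\<And>t. t \<in> carrier G \<Longrightarrow> d (x (r N)) (\<phi> t (x (r N))) \<le> C \<Longrightarrow> \<psi> t \<xi> = \<xi>"
      using small_displacement_fixes[OF coc, of C] by (metis comp_apply order_refl)
    have "T (r N) \<subseteq> stabilizer G \<psi> \<xi>"
    proof
      fix t assume t: "t \<in> T (r N)"
      then have "t \<in> carrier G" using gen(1) by blast
      then show "t \<in> stabilizer G \<psi> \<xi>" using N displ[OF t] by (simp add: stabilizer_def)
    qed
    then have "carrier G \<subseteq> stabilizer G \<psi> \<xi>"
      using generate_subgroup_incl[OF _ bd.stabilizer_subgroup[OF \<xi>(1)]] gen(2) by metis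
    then show ?thesis by (auto simp: stabilizer_def)
  qed
  consider "bounded_parabolic_point G (boundary_topology m) \<psi> \<xi>"
    | "conical_limit_point G (boundary_topology m) \<psi> \<xi>"
    using gf \<xi> by (auto simp: geometrically_finite_def)
  then show ?thesis
  proof cases
    case 1
    then obtain K where K: "compactin (boundary_topology m) K" "K \<subseteq> bdry - {\<xi>}"
      "(\<Union>g\<in>stabilizer G \<psi> \<xi>. \<psi> g ` K) = bdry - {\<xi>}"
      unfolding bounded_parabolic_point_def by auto
    obtain R where R: "\<And>q. q \<in> K \<Longrightarrow> \<not> prod_ge b R \<xi> q"
      using compact_avoiding_point_prod_bounded[OF b _ K(1) \<xi>(1)] conv K
      unfolding convergence_action_def by blast
    \<comment> \<open>An element of the stabilizer moves \<zeta> back into \<open>K\<close>, where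
      products with \<xi> are bounded.\<close>
    have "\<exists>p\<in>carrier G. \<psi> p \<xi> = \<xi> \<and> \<not> prod_ge b R \<xi> (\<psi> p \<zeta>)" if \<zeta>: "\<zeta> \<in> bdry" "\<zeta> \<noteq> \<xi>" for \<zeta>
    proof -
      obtain g k where gk: "g \<in> stabilizer G \<psi> \<xi>" "k \<in> K" "\<zeta> = \<psi> g k" using K \<zeta> by blast
      then have g: "g \<in> carrier G" "\<psi> g \<xi> = \<xi>" by (auto simp: stabilizer_def)
      have "\<psi> (inv g) \<zeta> = k" using bd.orbit_sym_aux[of g k \<zeta>] gk g K by auto
      moreover have "\<psi> (inv g) \<xi> = \<xi>" using bd.orbit_sym_aux[of g \<xi> \<xi>] g \<xi> by simp
      ultimately show ?thesis using R gk g by (metis inv_closed)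
    qed
    then have "carrier G = stabilizer G \<psi> \<xi>" using stab by metis
    then show ?thesis using 1 unfolding maximal_parabolics_def by blast
  next
    case 2
    \<comment> \<open>One of the two distinct limits in the definition of a conical limit point
      differs from \<xi>.\<close>
    then have "\<exists>\<eta>\<in>bdry. \<eta> \<noteq> \<xi>"
      unfolding conical_limit_point_def topspace_boundary_topology by metis
    then obtain \<eta> where \<eta>: "\<eta> \<in> bdry" "\<eta> \<noteq> \<xi>" by blast
    have two: "\<zeta> = \<xi> \<or> \<zeta> = \<eta>" if "\<zeta> \<in> bdry" for \<zeta>
      using no_conical_limit_point[OF 2 \<eta> that] by blast
    obtain R where R: "\<not> prod_ge b R \<xi> \<eta>" using ex_not_prod_ge b \<eta> \<xi> by metis
    have one: "\<psi> \<one> \<zeta> = \<zeta>" if "\<zeta> \<in> bdry" for \<zeta>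
      using bd.id_eq_one that by (metis restrict_apply')
    \<comment> \<open>With only one other boundary point, the identity already serves as the
      \<open>p\<close> of the cocompactness condition.\<close>
    have "stabilizer G \<psi> \<xi> = carrier G"
      by (rule stab[of R]) (use two one \<xi> \<eta> R in \<open>metis one_closed\<close>)
    then have fixed: "\<psi> g \<xi> = \<xi>" if "g \<in> carrier G" for g using that by (auto simp: stabilizer_def)
    have "\<psi> g \<eta> = \<eta>" if g: "g \<in> carrier G" for g
      using two[of "\<psi> g \<eta>"] fixed[OF g] \<eta> \<xi> g bd.inj_prop[OF g] by (metis boundary_action_closed inj_onD)
    then obtain B where B: "\<And>g. g \<in> carrier G \<Longrightarrow> d b (\<phi> g b) \<le> B"
      using fixed_pair_bounded_orbit[OF \<eta> fixed] by blast
    have "compactin (mtopology_of m) (mcball_of m b B)"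
      using proper b unfolding proper_metric_def by blast
    then have "finite {g \<in> carrier G. \<phi> g ` mcball_of m b B \<inter> mcball_of m b B \<noteq> {}}"
      using disc unfolding properly_discontinuous_def by blast
    moreover have "\<phi> g b \<in> \<phi> g ` mcball_of m b B \<inter> mcball_of m b B" if "g \<in> carrier G" for g
      using B[OF that] B[OF one_closed] b that by auto
    then have "carrier G \<subseteq> {g \<in> carrier G. \<phi> g ` mcball_of m b B \<inter> mcball_of m b B \<noteq> {}}"
      by blast
    ultimately show ?thesis using finite_subset by blast
  qed
qed

end

section \<open>Inner automorphisms and finite quotients\<close>

text \<open>Restricted to the carrier, since elements of \<open>auto G\<close> are extensional
  functions.\<close>

definition inner_aut :: "('a, 'b) monoid_scheme \<Rightarrow> 'a \<Rightarrow> 'a \<Rightarrow> 'a" where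
  "inner_aut G g = (\<lambda>x\<in>carrier G. g \<otimes>\<^bsub>G\<^esub> x \<otimes>\<^bsub>G\<^esub> inv\<^bsub>G\<^esub> g)"

lemma Inn_eq: "Inn G = inner_aut G ` carrier G"
  by (simp add: Inn_def inner_aut_def)

lemma carrier_AutoGroup [simp]: "carrier (AutoGroup G) = auto G"
  by (simp add: AutoGroup_def)

lemma one_AutoGroup: "\<one>\<^bsub>AutoGroup G\<^esub> = (\<lambda>x\<in>carrier G. x)"
  by (simp add: AutoGroup_def BijGroup_def)

lemma mult_AutoGroup:
  "\<alpha> \<in> auto G \<Longrightarrow> \<beta> \<in> auto G \<Longrightarrow> \<alpha> \<otimes>\<^bsub>AutoGroup G\<^esub> \<beta> = compose (carrier G) \<alpha> \<beta>"
  by (simp add: AutoGroup_def BijGroup_def auto_def)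

lemma auto_closed: "\<alpha> \<in> auto G \<Longrightarrow> x \<in> carrier G \<Longrightarrow> \<alpha> x \<in> carrier G"
  by (auto simp: auto_def hom_def)

lemma auto_mult:
  "\<alpha> \<in> auto G \<Longrightarrow> x \<in> carrier G \<Longrightarrow> y \<in> carrier G \<Longrightarrow> \<alpha> (x \<otimes>\<^bsub>G\<^esub> y) = \<alpha> x \<otimes>\<^bsub>G\<^esub> \<alpha> y"
  by (auto simp: auto_def hom_def)

lemma auto_eqI:
  assumes "\<alpha> \<in> auto G" "\<beta> \<in> auto G" "\<And>x. x \<in> carrier G \<Longrightarrow> \<alpha> x = \<beta> x"
  shows "\<alpha> = \<beta>"
  using assms by (intro extensionalityI[of _ "carrier G"]) (auto simp: auto_def Bij_def)

lemma auto_image: "\<alpha> \<in> auto G \<Longrightarrow> \<alpha> ` carrier G = carrier G"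
  by (simp add: auto_def Bij_def bij_betw_def)

lemma (in group) auto_group_hom: "\<alpha> \<in> auto G \<Longrightarrow> group_hom G G \<alpha>"
  by (simp add: group_hom_def group_hom_axioms_def auto_def)

lemma (in group) conjugate_mult:
  assumes "g \<in> carrier G" "x \<in> carrier G" "y \<in> carrier G"
  shows "g \<otimes> (x \<otimes> y) \<otimes> inv g = (g \<otimes> x \<otimes> inv g) \<otimes> (g \<otimes> y \<otimes> inv g)"
proof -
  have "inv g \<otimes> (g \<otimes> y \<otimes> inv g) = y \<otimes> inv g" using assms by (simp add: m_assoc[symmetric])
  then show ?thesis using assms by (simp add: m_assoc)
qed

lemma (in group) conjugate_conjugate:
  assumes "g \<in> carrier G" "h \<in> carrier G" "x \<in> carrier G"
  shows "g \<otimes> (h \<otimes> x \<otimes> inv h) \<otimes> inv g = (g \<otimes> h) \<otimes> x \<otimes> inv (g \<otimes> h)"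
  using assms by (simp add: m_assoc inv_mult_group)

lemma (in group) inv_conjugate_conjugate:
  assumes "g \<in> carrier G" "x \<in> carrier G"
  shows "inv g \<otimes> (g \<otimes> x \<otimes> inv g) \<otimes> g = x"
  using conjugate_conjugate[of "inv g" g x] assms by simp

lemma (in group) inner_aut_in_auto:
  assumes g: "g \<in> carrier G"
  shows "inner_aut G g \<in> auto G"
proof -
  have "bij_betw (inner_aut G g) (carrier G) (carrier G)"
  proof (rule bij_betw_byWitness[where f' = "inner_aut G (inv g)"])
    show "\<forall>x\<in>carrier G. inner_aut G (inv g) (inner_aut G g x) = x"
      using inv_conjugate_conjugate[OF g] g by (simp add: inner_aut_def)
    show "\<forall>x\<in>carrier G. inner_aut G g (inner_aut G (inv g) x) = x"
      using inv_conjugate_conjugate[of "inv g"] g by (simp add: inner_aut_def)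
  qed (use g in \<open>auto simp: inner_aut_def\<close>)
  then show ?thesis
    using g conjugate_mult[OF g] by (auto simp: auto_def Bij_def hom_def inner_aut_def)
qed

lemma (in group) inner_aut_group_hom: "group_hom G (AutoGroup G) (inner_aut G)"
proof (unfold group_hom_def group_hom_axioms_def, intro conjI)
  show "inner_aut G \<in> hom G (AutoGroup G)"
  proof (rule homI)
    fix g h assume gh: "g \<in> carrier G" "h \<in> carrier G"
    show "inner_aut G (g \<otimes> h) = inner_aut G g \<otimes>\<^bsub>AutoGroup G\<^esub> inner_aut G h"
      unfolding mult_AutoGroup[OF inner_aut_in_auto[OF gh(1)] inner_aut_in_auto[OF gh(2)]]
      using gh conjugate_conjugate[OF gh] by (auto simp: inner_aut_def compose_def)
  qed (simp add: inner_aut_in_auto)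
qed (simp_all add: AutoGroup)

lemma (in group) Inn_normal: "Inn G \<lhd> AutoGroup G"
proof -
  interpret A: group "AutoGroup G" by (rule AutoGroup)
  interpret c: group_hom G "AutoGroup G" "inner_aut G" by (rule inner_aut_group_hom)
  have "\<alpha> \<otimes>\<^bsub>AutoGroup G\<^esub> \<iota> \<otimes>\<^bsub>AutoGroup G\<^esub> inv\<^bsub>AutoGroup G\<^esub> \<alpha> \<in> Inn G"
    if \<alpha>: "\<alpha> \<in> auto G" and \<iota>: "\<iota> \<in> Inn G" for \<alpha> \<iota>
  proof -
    interpret h: group_hom G G \<alpha> using auto_group_hom[OF \<alpha>] .
    obtain g where g: "g \<in> carrier G" "\<iota> = inner_aut G g" using \<iota> by (auto simp: Inn_eq)
    have in_auto: "inner_aut G g \<in> auto G" "inner_aut G (\<alpha> g) \<in> auto G"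
      using inner_aut_in_auto g by auto
    have "\<alpha> \<otimes>\<^bsub>AutoGroup G\<^esub> inner_aut G g = inner_aut G (\<alpha> g) \<otimes>\<^bsub>AutoGroup G\<^esub> \<alpha>"
      unfolding mult_AutoGroup[OF \<alpha> in_auto(1)] mult_AutoGroup[OF in_auto(2) \<alpha>]
      using g by (auto simp: compose_def inner_aut_def)
    then have "\<alpha> \<otimes>\<^bsub>AutoGroup G\<^esub> \<iota> \<otimes>\<^bsub>AutoGroup G\<^esub> inv\<^bsub>AutoGroup G\<^esub> \<alpha> = inner_aut G (\<alpha> g)"
      using g \<alpha> in_auto A.inv_closed[of \<alpha>] by (simp add: A.m_assoc)
    then show ?thesis using g by (auto simp: Inn_eq)
  qed
  then show ?thesis
    using c.img_is_subgroup by (simp add: A.normal_inv_iff Inn_eq)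
qed

lemma (in group_hom) eq_on_generate:
  assumes "group_hom G H h'" "S \<subseteq> carrier G" "\<And>s. s \<in> S \<Longrightarrow> h s = h' s" "x \<in> generate G S"
  shows "h x = h' x"
proof -
  interpret h': group_hom G H h' by fact
  show ?thesis
    using assms(4)
    by (induction rule: generate.induct)
      (use assms(2,3) G.generate_in_carrier[OF assms(2)] in \<open>auto simp: subset_iff\<close>)
qed

lemma (in group) auto_eq_if_eq_on_generators:
  assumes "\<alpha> \<in> auto G" "\<beta> \<in> auto G" "S \<subseteq> carrier G" "generate G S = carrier G"
    and "\<And>s. s \<in> S \<Longrightarrow> \<alpha> s = \<beta> s"
  shows "\<alpha> = \<beta>"
  using assms group_hom.eq_on_generate[OF auto_group_hom auto_group_hom, of \<alpha> \<beta> S]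
  by (intro auto_eqI) auto

text \<open>Each fibre of \<open>f\<close> lies in a single coset, so choosing a preimage of every
  value reaches all cosets.\<close>

lemma (in group) finite_rcosets_if_finite_invariant:
  assumes K: "subgroup K G" and fin: "finite (f ` carrier G)"
    and f: "\<And>x y. \<lbrakk>x \<in> carrier G; y \<in> carrier G; f x = f y\<rbrakk> \<Longrightarrow> y \<otimes> inv x \<in> K"
  shows "finite (rcosets K)"
proof -
  have eq: "K #> x = K #> y" if "x \<in> carrier G" "y \<in> carrier G" "f x = f y" for x y
  proof -
    have "y = (y \<otimes> inv x) \<otimes> x" using that by (simp add: m_assoc)
    then have "y \<in> K #> x" using f[OF that] by (auto simp: r_coset_def)
    then show ?thesis using repr_independence that K by blast
  qed
  have "rcosets K \<subseteq> (\<lambda>z. K #> inv_into (carrier G) f z) ` f ` carrier G"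
  proof
    fix C assume "C \<in> rcosets K"
    then obtain x where x: "x \<in> carrier G" "C = K #> x" by (auto simp: RCOSETS_def)
    have "C = K #> inv_into (carrier G) f (f x)"
      unfolding x(2) by (rule eq) (use x in \<open>auto simp: inv_into_into f_inv_into_f\<close>)
    then show "C \<in> (\<lambda>z. K #> inv_into (carrier G) f z) ` f ` carrier G" using x by blast
  qed
  then show ?thesis using fin finite_subset by blast
qed

text \<open>The stabilizer of the class of \<open>h\<close> under the action of \<open>Aut(G)\<close> on homomorphisms modulo
  conjugation in the target.\<close>

definition class_stabilizer ::
    "('a, 'b) monoid_scheme \<Rightarrow> ('c, 'd) monoid_scheme \<Rightarrow> ('a \<Rightarrow> 'c) \<Rightarrow> ('a \<Rightarrow> 'a) set" where
  "class_stabilizer G H h = {\<alpha> \<in> auto G. \<exists>q\<in>carrier H. \<forall>x\<in>carrier G.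
     h (\<alpha> x) = q \<otimes>\<^bsub>H\<^esub> h x \<otimes>\<^bsub>H\<^esub> inv\<^bsub>H\<^esub> q}"

context group_hom
begin

lemma subgroup_class_stabilizer: "subgroup (class_stabilizer G H h) (AutoGroup G)"
proof -
  interpret A: group "AutoGroup G" by (rule G.AutoGroup)
  show ?thesis
  proof (rule A.subgroupI)
    show "class_stabilizer G H h \<subseteq> carrier (AutoGroup G)" by (auto simp: class_stabilizer_def)
    have "\<one>\<^bsub>AutoGroup G\<^esub> \<in> class_stabilizer G H h"
      using A.one_closed by (auto simp: class_stabilizer_def one_AutoGroup intro!: bexI[of _ "\<one>\<^bsub>H\<^esub>"])
    then show "class_stabilizer G H h \<noteq> {}" by blast
  next
    fix \<alpha> assume "\<alpha> \<in> class_stabilizer G H h"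
    then obtain q where \<alpha>: "\<alpha> \<in> auto G" and q: "q \<in> carrier H"
      "\<And>x. x \<in> carrier G \<Longrightarrow> h (\<alpha> x) = q \<otimes>\<^bsub>H\<^esub> h x \<otimes>\<^bsub>H\<^esub> inv\<^bsub>H\<^esub> q"
      by (auto simp: class_stabilizer_def)
    let ?\<beta> = "inv\<^bsub>AutoGroup G\<^esub> \<alpha>"
    have \<beta>: "?\<beta> \<in> auto G" using A.inv_closed \<alpha> by simp
    have "h (?\<beta> x) = inv\<^bsub>H\<^esub> q \<otimes>\<^bsub>H\<^esub> h x \<otimes>\<^bsub>H\<^esub> inv\<^bsub>H\<^esub> (inv\<^bsub>H\<^esub> q)" if x: "x \<in> carrier G" for x
    proof -
      have "compose (carrier G) \<alpha> ?\<beta> x = x"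
        using A.r_inv[of \<alpha>] mult_AutoGroup[OF \<alpha> \<beta>] \<alpha> x by (simp add: one_AutoGroup)
      then have "h x = q \<otimes>\<^bsub>H\<^esub> h (?\<beta> x) \<otimes>\<^bsub>H\<^esub> inv\<^bsub>H\<^esub> q"
        using q(2)[of "?\<beta> x"] auto_closed[OF \<beta> x] x by (simp add: compose_def)
      then show ?thesis
        using H.inv_conjugate_conjugate[of q "h (?\<beta> x)"] q auto_closed[OF \<beta> x] by simp
    qed
    then show "?\<beta> \<in> class_stabilizer G H h"
      using \<beta> q by (auto simp: class_stabilizer_def intro!: bexI[of _ "inv\<^bsub>H\<^esub> q"])
  next
    fix \<alpha> \<beta> assume "\<alpha> \<in> class_stabilizer G H h" "\<beta> \<in> class_stabilizer G H h"
    then obtain q r where \<alpha>: "\<alpha> \<in> auto G" and q: "q \<in> carrier H"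
      "\<And>x. x \<in> carrier G \<Longrightarrow> h (\<alpha> x) = q \<otimes>\<^bsub>H\<^esub> h x \<otimes>\<^bsub>H\<^esub> inv\<^bsub>H\<^esub> q"
      and \<beta>: "\<beta> \<in> auto G" and r: "r \<in> carrier H"
      "\<And>x. x \<in> carrier G \<Longrightarrow> h (\<beta> x) = r \<otimes>\<^bsub>H\<^esub> h x \<otimes>\<^bsub>H\<^esub> inv\<^bsub>H\<^esub> r"
      by (auto simp: class_stabilizer_def)
    have "h ((\<alpha> \<otimes>\<^bsub>AutoGroup G\<^esub> \<beta>) x)
        = (q \<otimes>\<^bsub>H\<^esub> r) \<otimes>\<^bsub>H\<^esub> h x \<otimes>\<^bsub>H\<^esub> inv\<^bsub>H\<^esub> (q \<otimes>\<^bsub>H\<^esub> r)" if x: "x \<in> carrier G" for x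
      using H.conjugate_conjugate[OF q(1) r(1), of "h x"] x auto_closed[OF \<beta> x] q r
      by (simp add: mult_AutoGroup[OF \<alpha> \<beta>] compose_def)
    then show "\<alpha> \<otimes>\<^bsub>AutoGroup G\<^esub> \<beta> \<in> class_stabilizer G H h"
      using A.m_closed[of \<alpha> \<beta>] \<alpha> \<beta> q r
      by (auto simp: class_stabilizer_def intro!: bexI[of _ "q \<otimes>\<^bsub>H\<^esub> r"])
  qed
qed

lemma Inn_subset_class_stabilizer: "Inn G \<subseteq> class_stabilizer G H h"
proof
  fix \<iota> assume "\<iota> \<in> Inn G"
  then obtain g where g: "g \<in> carrier G" "\<iota> = inner_aut G g" by (auto simp: Inn_eq)
  then show "\<iota> \<in> class_stabilizer G H h"
    using G.inner_aut_in_auto[OF g(1)]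
    by (auto simp: class_stabilizer_def inner_aut_def intro!: bexI[of _ "h g"])
qed

lemma class_stabilizerI:
  assumes \<alpha>: "\<alpha> \<in> auto G" and \<beta>: "\<beta> \<in> auto G" and S: "S \<subseteq> carrier G" "generate G S = carrier G"
    and eq: "\<And>s. s \<in> S \<Longrightarrow> h (\<alpha> s) = h (\<beta> s)"
  shows "\<beta> \<otimes>\<^bsub>AutoGroup G\<^esub> inv\<^bsub>AutoGroup G\<^esub> \<alpha> \<in> class_stabilizer G H h"
proof -
  interpret A: group "AutoGroup G" by (rule G.AutoGroup)
  let ?\<gamma> = "inv\<^bsub>AutoGroup G\<^esub> \<alpha>"
  have \<gamma>: "?\<gamma> \<in> auto G" using A.inv_closed \<alpha> by simp
  have hom: "group_hom G H (h \<circ> \<alpha>)" "group_hom G H (h \<circ> \<beta>)"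
    using \<alpha> \<beta> homh by (auto simp: group_hom_def group_hom_axioms_def auto_def intro: Group.hom_compose)
  have agree: "h (\<alpha> x) = h (\<beta> x)" if "x \<in> carrier G" for x
    using group_hom.eq_on_generate[OF hom S(1), of x] eq that S by auto
  have "h ((\<beta> \<otimes>\<^bsub>AutoGroup G\<^esub> ?\<gamma>) x) = h x" if x: "x \<in> carrier G" for x
  proof -
    have "compose (carrier G) \<alpha> ?\<gamma> x = x"
      using A.r_inv[of \<alpha>] mult_AutoGroup[OF \<alpha> \<gamma>] \<alpha> x by (simp add: one_AutoGroup)
    then show ?thesis
      using agree[OF auto_closed[OF \<gamma> x]] x by (simp add: mult_AutoGroup[OF \<beta> \<gamma>] compose_def)
  qed
  then show ?thesis
    using A.m_closed[of \<beta> ?\<gamma>] \<beta> \<gamma> by (auto simp: class_stabilizer_def intro!: bexI[of _ "\<one>\<^bsub>H\<^esub>"])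
qed

end

section \<open>Finite-index subgroups of the outer automorphism group\<close>

lemma (in group) Out_hom: "group_hom (AutoGroup G) (OutGroup G) (\<lambda>\<alpha>. Inn G #>\<^bsub>AutoGroup G\<^esub> \<alpha>)"
  using normal.r_coset_hom_Mod[OF Inn_normal] normal.factorgroup_is_group[OF Inn_normal] AutoGroup
  by (simp add: group_hom_def group_hom_axioms_def OutGroup_def)

lemma (in group) OutE:
  assumes "c \<in> carrier (OutGroup G)"
  obtains \<alpha> where "\<alpha> \<in> auto G" "c = Inn G #>\<^bsub>AutoGroup G\<^esub> \<alpha>"
  using assms by (auto simp: OutGroup_def FactGroup_def RCOSETS_def)

text \<open>A homomorphism from \<open>G\<close> to the finite group \<open>Q\<close> is determined
  by its values on a finite generating set, so there are finitely many, and the stabilizer of the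
  class of \<pi> has finite index. It contains \<open>Inn G\<close>; hence its image in
  \<open>OutGroup G\<close> still misses the class of \<alpha>.\<close>

lemma (in group) finite_index_excluding:
  assumes Q: "group_hom G Q \<pi>" "finite (carrier Q)" and fg: "fin_gen G (carrier G)"
    and L: "subgroup L (OutGroup G)"
    and \<alpha>: "\<alpha> \<in> auto G" "\<alpha> \<notin> class_stabilizer G Q \<pi>"
  obtains K where "finite_index ((OutGroup G)\<lparr>carrier := L\<rparr>) K" "Inn G #>\<^bsub>AutoGroup G\<^esub> \<alpha> \<notin> K"
proof -
  interpret \<pi>: group_hom G Q \<pi> by fact
  interpret p: group_hom "AutoGroup G" "OutGroup G" "\<lambda>\<alpha>. Inn G #>\<^bsub>AutoGroup G\<^esub> \<alpha>" by (rule Out_hom)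
  define p where "p = (\<lambda>\<alpha>. Inn G #>\<^bsub>AutoGroup G\<^esub> \<alpha>)"
  define B where "B = class_stabilizer G Q \<pi>"
  define K where "K = L \<inter> p ` B"
  let ?L = "(OutGroup G)\<lparr>carrier := L\<rparr>"
  have B: "subgroup B (AutoGroup G)" unfolding B_def by (rule \<pi>.subgroup_class_stabilizer)
  have "subgroup (p ` B) (OutGroup G)"
    unfolding p_def using p.subgroup_img_is_subgroup[OF B] .
  then have KO: "subgroup K (OutGroup G)"
    unfolding K_def using p.H.subgroups_Inter_pair[OF L] by blast
  have Lg: "group ?L" using L p.H.subgroup_imp_group by blast
  then interpret L: group ?L .
  have KL: "subgroup K ?L"
    using p.H.subgroup_incl[OF KO L] by (simp add: K_def)
  obtain S where S: "finite S" "S \<subseteq> carrier G" "generate G S = carrier G"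
    using fg by (auto simp: fin_gen_def)
  have Lsub: "L \<subseteq> carrier (OutGroup G)" using L subgroup.subset by blast
  then have "\<exists>\<beta>. \<beta> \<in> auto G \<and> c = p \<beta>" if "c \<in> L" for c
    using that OutE unfolding p_def by blast
  then obtain rep where rep: "\<And>c. c \<in> L \<Longrightarrow> rep c \<in> auto G" "\<And>c. c \<in> L \<Longrightarrow> c = p (rep c)"
    by metis
  define f where "f = (\<lambda>c. restrict (\<lambda>s. \<pi> (rep c s)) S)"
  have "\<pi> (rep c s) \<in> carrier Q" if "c \<in> L" "s \<in> S" for c s
    using \<pi>.hom_closed auto_closed[OF rep(1)[OF that(1)]] S(2) that(2) by blast
  then have "f ` L \<subseteq> S \<rightarrow>\<^sub>E carrier Q" by (auto simp: f_def)
  then have "finite (f ` carrier ?L)"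
    using finite_PiE[OF S(1), of "\<lambda>_. carrier Q"] Q(2) finite_subset by auto
  moreover have "c' \<otimes>\<^bsub>?L\<^esub> inv\<^bsub>?L\<^esub> c \<in> K" if c: "c \<in> carrier ?L" "c' \<in> carrier ?L" and eq: "f c = f c'" for c c'
  proof -
    have "\<pi> (rep c s) = \<pi> (rep c' s)" if "s \<in> S" for s
      using fun_cong[OF eq, of s] that by (simp add: f_def)
    then have "rep c' \<otimes>\<^bsub>AutoGroup G\<^esub> inv\<^bsub>AutoGroup G\<^esub> (rep c) \<in> B"
      unfolding B_def using \<pi>.class_stabilizerI[OF _ _ S(2,3)] rep c by auto
    moreover have "p (rep c' \<otimes>\<^bsub>AutoGroup G\<^esub> inv\<^bsub>AutoGroup G\<^esub> (rep c)) = c' \<otimes>\<^bsub>?L\<^esub> inv\<^bsub>?L\<^esub> c"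
    proof -
      have rc: "rep c \<in> auto G" "rep c' \<in> auto G" "p (rep c) = c" "p (rep c') = c'"
        using rep[of c] rep[of c'] c by auto
      have "p (rep c' \<otimes>\<^bsub>AutoGroup G\<^esub> inv\<^bsub>AutoGroup G\<^esub> (rep c))
          = p (rep c') \<otimes>\<^bsub>OutGroup G\<^esub> inv\<^bsub>OutGroup G\<^esub> (p (rep c))"
        using rc p.hom_mult[of "rep c'" "inv\<^bsub>AutoGroup G\<^esub> (rep c)"] p.hom_inv[of "rep c"]
          p.G.inv_closed[of "rep c"] by (simp add: p_def)
      then show ?thesis using rc c p.H.m_inv_consistent[OF L] by simp
    qed
    ultimately have "c' \<otimes>\<^bsub>?L\<^esub> inv\<^bsub>?L\<^esub> c \<in> p ` B" by (metis imageI)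
    moreover have "c' \<otimes>\<^bsub>?L\<^esub> inv\<^bsub>?L\<^esub> c \<in> L"
      using L.m_closed[OF c(2) L.inv_closed[OF c(1)]] by simp
    ultimately show ?thesis by (simp add: K_def)
  qed
  ultimately have "finite (rcosets\<^bsub>?L\<^esub> K)"
    using L.finite_rcosets_if_finite_invariant[OF KL] by blast
  then have "finite_index ?L K" using KL by (simp add: finite_index_def)
  moreover have "p \<alpha> \<notin> K"
  proof
    assume "p \<alpha> \<in> K"
    then obtain \<beta> where \<beta>: "\<beta> \<in> B" "p \<alpha> = p \<beta>" by (auto simp: K_def)
    \<comment> \<open>Equal classes mean that \<alpha> and \<beta> differ by an inner automorphism,
      which lies in \<open>B\<close>.\<close>
    have "\<alpha> \<in> Inn G #>\<^bsub>AutoGroup G\<^esub> \<alpha>"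
      using p.G.rcos_self[of \<alpha> "Inn G"] \<alpha> normal_imp_subgroup[OF Inn_normal] by simp
    then obtain \<iota> where "\<iota> \<in> Inn G" "\<alpha> = \<iota> \<otimes>\<^bsub>AutoGroup G\<^esub> \<beta>"
      using \<beta> by (auto simp: p_def r_coset_def)
    then have "\<alpha> \<in> B"
      using subgroup.m_closed[OF B] \<beta> \<pi>.Inn_subset_class_stabilizer by (auto simp: B_def)
    then show False using \<alpha> by (simp add: B_def)
  qed
  ultimately show ?thesis using that by (simp add: p_def)
qed

section \<open>Pointwise inner automorphisms\<close>

lemma (in group) pointwise_inner_pow:
  assumes \<alpha>: "\<alpha> \<in> auto G" and inner: "\<And>x. x \<in> carrier G \<Longrightarrow> conj_in G x (\<alpha> x)"
    and x: "x \<in> carrier G"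
  shows "conj_in G x ((\<alpha> [^]\<^bsub>AutoGroup G\<^esub> (n::nat)) x)"
proof -
  interpret A: group "AutoGroup G" by (rule AutoGroup)
  show ?thesis
  proof (induction n)
    case 0
    show ?case
      using x by (auto simp: conj_in_def one_AutoGroup intro!: bexI[of _ \<one>])
  next
    case (Suc n)
    have pow: "\<alpha> [^]\<^bsub>AutoGroup G\<^esub> n \<in> auto G" using A.nat_pow_closed \<alpha> by simp
    let ?y = "(\<alpha> [^]\<^bsub>AutoGroup G\<^esub> n) x"
    have y: "?y \<in> carrier G" using auto_closed[OF pow x] .
    obtain g where g: "g \<in> carrier G" "?y = g \<otimes> x \<otimes> inv g"
      using Suc by (auto simp: conj_in_def)
    obtain h where h: "h \<in> carrier G" "\<alpha> ?y = h \<otimes> ?y \<otimes> inv h"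
      using inner[OF y] by (auto simp: conj_in_def)
    have "\<alpha> [^]\<^bsub>AutoGroup G\<^esub> Suc n = compose (carrier G) \<alpha> (\<alpha> [^]\<^bsub>AutoGroup G\<^esub> n)"
      using A.nat_pow_Suc2[of \<alpha> n] mult_AutoGroup[OF \<alpha> pow] \<alpha> by simp
    then have "(\<alpha> [^]\<^bsub>AutoGroup G\<^esub> Suc n) x = h \<otimes> ?y \<otimes> inv h"
      using h x by (simp add: compose_def)
    then have "(\<alpha> [^]\<^bsub>AutoGroup G\<^esub> Suc n) x = (h \<otimes> g) \<otimes> x \<otimes> inv (h \<otimes> g)"
      using conjugate_conjugate[OF h(1) g(1) x] g(2) by simp
    then show ?case using g h by (auto simp: conj_in_def)
  qed
qed

text \<open>By the pigeonhole principle two of the modified powers agree on \<open>S\<close>, hence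
  coincide; cancelling the smaller power of \<alpha> leaves an inner automorphism.\<close>

lemma (in group) inner_power_if_finite_images:
  assumes \<alpha>: "\<alpha> \<in> auto G" and S: "finite S" "S \<subseteq> carrier G" "generate G S = carrier G"
    and g: "\<And>i. g i \<in> carrier G"
    and I: "infinite I" and F: "finite F"
    and img: "\<And>i s. i \<in> I \<Longrightarrow> s \<in> S \<Longrightarrow>
      (inner_aut G (g i) \<otimes>\<^bsub>AutoGroup G\<^esub> \<alpha> [^]\<^bsub>AutoGroup G\<^esub> (i::nat)) s \<in> F"
  shows "\<exists>n>0. \<alpha> [^]\<^bsub>AutoGroup G\<^esub> (n::nat) \<in> Inn G"
proof -
  interpret A: group "AutoGroup G" by (rule AutoGroup)
  define pw where "pw = (\<lambda>i::nat. \<alpha> [^]\<^bsub>AutoGroup G\<^esub> i)"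
  define \<beta> where "\<beta> = (\<lambda>i. inner_aut G (g i) \<otimes>\<^bsub>AutoGroup G\<^esub> pw i)"
  have pw: "pw i \<in> carrier (AutoGroup G)" for i using A.nat_pow_closed \<alpha> by (simp add: pw_def)
  have in_aut: "inner_aut G (g i) \<in> carrier (AutoGroup G)" for i
    using inner_aut_in_auto g by simp
  have \<beta>: "\<beta> i \<in> auto G" for i using A.m_closed[OF in_aut pw] by (simp add: \<beta>_def)
  have "(\<lambda>i. restrict (\<beta> i) S) ` I \<subseteq> S \<rightarrow>\<^sub>E F"
    using img by (auto simp: \<beta>_def pw_def)
  then have "finite ((\<lambda>i. restrict (\<beta> i) S) ` I)"
    using finite_PiE[OF S(1), of "\<lambda>_. F"] F finite_subset by blast
  then have "\<not> inj_on (\<lambda>i. restrict (\<beta> i) S) I"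
    using I finite_imageD by blast
  then obtain i j where "i \<noteq> j" "restrict (\<beta> i) S = restrict (\<beta> j) S"
    by (auto simp: inj_on_def)
  then obtain i j where ij: "i < j" "restrict (\<beta> i) S = restrict (\<beta> j) S"
    by (metis linorder_neqE_nat)
  have "\<beta> i s = \<beta> j s" if "s \<in> S" for s using fun_cong[OF ij(2), of s] that by simp
  then have eq: "\<beta> i = \<beta> j" using auto_eq_if_eq_on_generators[OF \<beta> \<beta> S(2,3)] by blast
  define n where "n = j - i"
  have pj: "pw j = pw n \<otimes>\<^bsub>AutoGroup G\<^esub> pw i"
    using A.nat_pow_mult[of \<alpha> n i] \<alpha> ij by (simp add: pw_def n_def)
  have "inner_aut G (g i) \<otimes>\<^bsub>AutoGroup G\<^esub> pw i
      = (inner_aut G (g j) \<otimes>\<^bsub>AutoGroup G\<^esub> pw n) \<otimes>\<^bsub>AutoGroup G\<^esub> pw i"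
    using eq A.m_assoc[OF in_aut pw pw] by (simp add: \<beta>_def pj)
  then have *: "inner_aut G (g i) = inner_aut G (g j) \<otimes>\<^bsub>AutoGroup G\<^esub> pw n"
    using A.right_cancel[OF pw in_aut A.m_closed[OF in_aut pw]] by blast
  have sub: "subgroup (Inn G) (AutoGroup G)"
    using normal_imp_subgroup[OF Inn_normal] .
  have Inn: "inner_aut G (g i) \<in> Inn G" for i using g by (auto simp: Inn_eq)
  have "pw n = inv\<^bsub>AutoGroup G\<^esub> (inner_aut G (g j)) \<otimes>\<^bsub>AutoGroup G\<^esub> inner_aut G (g i)"
    using A.inv_solve_left[OF pw in_aut in_aut] * by blast
  then have "pw n \<in> Inn G"
    using subgroup.m_closed[OF sub subgroup.m_inv_closed[OF sub Inn] Inn] by simp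
  then show ?thesis using ij(1) by (intro exI[of _ n]) (simp add: pw_def n_def)
qed

lemma (in hyperbolic_action) ex_almost_nearest_orbit_point:
  assumes "b \<in> M" "y \<in> M"
  obtains g where "g \<in> carrier G" "\<And>h. h \<in> carrier G \<Longrightarrow> d y (\<phi> g b) \<le> d y (\<phi> h b) + 1"
proof -
  let ?D = "(\<lambda>g. d y (\<phi> g b)) ` carrier G"
  have ne: "?D \<noteq> {}" using one_closed by blast
  have bdd: "bdd_below ?D" by (auto intro: bdd_belowI[of _ 0])
  obtain g where g: "g \<in> carrier G" "d y (\<phi> g b) < Inf ?D + 1"
    using cInf_lessD[OF ne, of "Inf ?D + 1"] by auto
  have "d y (\<phi> g b) \<le> d y (\<phi> h b) + 1" if "h \<in> carrier G" for h
    using cInf_lower[OF imageI[OF that] bdd] g(2) by simp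
  then show ?thesis using that g by blast
qed

text \<open>An element of the image is conjugate to its preimage, so its displacement somewhere is that of
  the preimage at the base point.  Hence the powers of a pointwise inner automorphism move suitable
  points by a uniformly bounded amount.\<close>

lemma (in hyperbolic_action) pointwise_inner_power_inner:
  assumes rh: "rel_hyp_action G P m \<phi>" and nP: "carrier G \<notin> P" and fg: "fin_gen G (carrier G)"
    and \<alpha>: "\<alpha> \<in> auto G" and inner: "\<And>x. x \<in> carrier G \<Longrightarrow> conj_in G x (\<alpha> x)"
  shows "\<exists>n>0. \<alpha> [^]\<^bsub>AutoGroup G\<^esub> (n::nat) \<in> Inn G"
proof -
  interpret A: group "AutoGroup G" by (rule AutoGroup)
  have rh: "M \<noteq> {}" "proper_metric m" "path_metric m" "properly_discontinuous G m \<phi>"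
    "convergence_action G (boundary_topology m) \<psi>" "geometrically_finite G (boundary_topology m) \<psi>"
    "P = maximal_parabolics G (boundary_topology m) \<psi>"
    using rh unfolding rel_hyp_action_def by blast+
  obtain b where b: "b \<in> M" using rh(1) by blast
  obtain S0 where S0: "finite S0" "S0 \<subseteq> carrier G" "generate G S0 = carrier G"
    using fg by (auto simp: fin_gen_def)
  \<comment> \<open>Inserting the identity makes the set nonempty, as
    \<open>common_almost_fixed\<close> requires, and gives \<open>0 \<le> C\<close> below.\<close>
  define S where "S = insert \<one> S0"
  have S: "finite S" "S \<noteq> {}" "S \<subseteq> carrier G" using S0 by (auto simp: S_def)
  have gen: "generate G S = carrier G"
    using mono_generate[of S0 S] generate_incl[OF S(3)] S0(3) by (auto simp: S_def)
  define E where "E = S \<union> (\<lambda>(s, t). s \<otimes> t) ` (S \<times> S)"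
  have E: "finite E" "E \<subseteq> carrier G" using S by (auto simp: E_def)
  define D where "D = Max ((\<lambda>g. d b (\<phi> g b)) ` E)"
  have D: "d b (\<phi> g b) \<le> D" if "g \<in> E" for g using E(1) that by (simp add: D_def)
  define pw where "pw = (\<lambda>i::nat. \<alpha> [^]\<^bsub>AutoGroup G\<^esub> i)"
  have pw: "pw i \<in> auto G" for i using A.nat_pow_closed \<alpha> by (simp add: pw_def)
  define C where "C = 170 * D + 132 + 88 * \<delta>"
  have moved: "\<exists>y\<in>M. d y (\<phi> (pw i g) y) \<le> D" if g: "g \<in> E" for i g
  proof -
    have gG: "g \<in> carrier G" using g E by blast
    then obtain h where h: "h \<in> carrier G" "pw i g = h \<otimes> g \<otimes> inv h"
      using pointwise_inner_pow[OF \<alpha> inner gG, of i] by (auto simp: conj_in_def pw_def)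
    have "\<phi> (pw i g) (\<phi> h b) = \<phi> h (\<phi> g b)"
      using h gG b by (simp add: composition_rule)
    then have "d (\<phi> h b) (\<phi> (pw i g) (\<phi> h b)) \<le> D" using D[OF g] h gG b by simp
    then show ?thesis using h b by (meson act_closed)
  qed
  have "\<exists>y. y \<in> M \<and> (\<forall>s\<in>S. d y (\<phi> (pw i s) y) \<le> C)" for i
  proof -
    have sub: "pw i ` S \<subseteq> carrier G" using auto_closed[OF pw] S by blast
    have ell: "\<exists>y\<in>M. d y (\<phi> s y) \<le> D" if "s \<in> pw i ` S" for s
      using that moved by (auto simp: E_def)
    have ell2: "\<exists>y\<in>M. d y (\<phi> (s \<otimes> t) y) \<le> D" if st: "s \<in> pw i ` S" "t \<in> pw i ` S" for s t
    proof -
      obtain s' t' where st': "s' \<in> S" "t' \<in> S" "s = pw i s'" "t = pw i t'" using st by blast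
      then have "s \<otimes> t = pw i (s' \<otimes> t')"
        using auto_mult[OF pw[of i], of s' t'] S(3) by (simp add: subset_iff)
      moreover have "s' \<otimes> t' \<in> E" using st' by (auto simp: E_def)
      ultimately show ?thesis using moved by metis
    qed
    obtain y where "y \<in> M" "\<And>s. s \<in> pw i ` S \<Longrightarrow> d y (\<phi> s y) \<le> C"
      using common_almost_fixed[OF rh(3) _ _ sub rh(1) ell ell2] S unfolding C_def by blast
    then show ?thesis by blast
  qed
  then obtain y where y: "\<And>i. y i \<in> M" "\<And>i s. s \<in> S \<Longrightarrow> d (y i) (\<phi> (pw i s) (y i)) \<le> C"
    by metis
  have "\<exists>g. g \<in> carrier G \<and> (\<forall>h\<in>carrier G. d (y i) (\<phi> g b) \<le> d (y i) (\<phi> h b) + 1)" for i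
    using ex_almost_nearest_orbit_point[OF b y(1)] by metis
  then obtain g where g: "\<And>i. g i \<in> carrier G"
    "\<And>i h. h \<in> carrier G \<Longrightarrow> d (y i) (\<phi> (g i) b) \<le> d (y i) (\<phi> h b) + 1"
    by metis
  \<comment> \<open>Translating \<open>y i\<close> makes \<open>b\<close> itself an almost nearest
    orbit point; \<open>\<beta> i\<close> is conjugated accordingly, so that
    \<open>\<beta> i s\<close> moves \<open>x i\<close> exactly as far as \<open>pw i s\<close>
    moves \<open>y i\<close>.\<close>
  define x where "x = (\<lambda>i. \<phi> (inv (g i)) (y i))"
  define \<beta> where "\<beta> = (\<lambda>i. inner_aut G (inv (g i)) \<otimes>\<^bsub>AutoGroup G\<^esub> pw i)"
  have ia: "inner_aut G (inv (g i)) \<in> auto G" for i using inner_aut_in_auto g by blast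
  have \<beta>: "\<beta> i \<in> auto G" for i using A.m_closed[of "inner_aut G (inv (g i))"] ia pw by (simp add: \<beta>_def)
  have xM: "x i \<in> M" for i using g y by (simp add: x_def)
  have near: "d (x j) b \<le> d (x j) (\<phi> h b) + 1" if h: "h \<in> carrier G" for j h
  proof -
    have "d (x j) b = d (y j) (\<phi> (g j) b)" "d (x j) (\<phi> h b) = d (y j) (\<phi> (g j \<otimes> h) b)"
      using act_dist_inv[of "inv (g j)" "y j"] g y b h by (simp_all add: x_def composition_rule)
    then show ?thesis using g(2)[of "g j \<otimes> h" j] g(1) h by simp
  qed
  have displ: "d (x i) (\<phi> (\<beta> i s) (x i)) \<le> C" if s: "s \<in> S" for i s
  proof -
    have sG: "s \<in> carrier G" using s S by blast
    then have ps: "pw i s \<in> carrier G" using auto_closed[OF pw] by blast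
    have "\<beta> i s = inv (g i) \<otimes> pw i s \<otimes> g i"
    proof -
      have "\<beta> i s = inner_aut G (inv (g i)) (pw i s)"
        unfolding \<beta>_def mult_AutoGroup[OF ia pw] using sG by (simp add: compose_def)
      then show ?thesis using ps g(1) by (simp add: inner_aut_def)
    qed
    then have "\<phi> (\<beta> i s) (x i) = \<phi> (inv (g i)) (\<phi> (pw i s) (y i))"
      using ps g(1)[of i] y(1)[of i] by (simp add: x_def composition_rule)
    then show ?thesis using y(2)[OF s, of i] y(1)[of i] ps g(1)[of i] by (simp add: x_def)
  qed
  have fin_case: ?thesis if "infinite I" "finite F" "\<And>i s. i \<in> I \<Longrightarrow> s \<in> S \<Longrightarrow> \<beta> i s \<in> F" for I F
    by (rule inner_power_if_finite_images[OF \<alpha> S(1,3) gen, of "\<lambda>i. inv (g i)" I F])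
      (use that g in \<open>auto simp: \<beta>_def pw_def\<close>)
  show ?thesis
  proof (cases "filterlim (\<lambda>i. d b (x i)) at_top sequentially")
    case True
    have "generate G (\<beta> i ` S) = carrier G" for i
      using group_hom.generate_img[OF auto_group_hom[OF \<beta>] S(3)] gen auto_image[OF \<beta>] by metis
    then have "finite (carrier G) \<or> carrier G \<in> P"
      unfolding rh(7)
      by (intro finite_or_parabolic[OF rh(2-6) b _ near True, of "\<lambda>i. \<beta> i ` S" C])
        (use xM auto_closed[OF \<beta>] S displ in auto)
    then have "finite (carrier G)" using nP by blast
    \<comment> \<open>For finite \<open>G\<close> the pigeonhole argument applies to all powers at
      once, with \<open>F = carrier G\<close>.\<close>
    then show ?thesis
      by (rule fin_case[OF infinite_UNIV_nat]) (use auto_closed[OF \<beta>] S in blast)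
  next
    case False
    then obtain R where R: "\<not> (\<forall>\<^sub>F i in sequentially. R \<le> d b (x i))"
      by (auto simp: filterlim_at_top)
    define I where "I = {i. d b (x i) < R}"
    have I: "infinite I"
      using R by (simp add: I_def cofinite_eq_sequentially[symmetric] eventually_cofinite not_le)
    \<comment> \<open>The way from \<open>b\<close> to \<open>x i\<close>, on to its image under
      \<open>\<beta> i s\<close> and back to the image of \<open>b\<close> has length at most
      \<open>R + C + R\<close>; the absolute value keeps \<open>b\<close> in the ball whatever the
      sign of \<open>R\<close>.\<close>
    define r where "r = C + 2 * \<bar>R\<bar>"
    have C0: "0 \<le> C" using order_trans[OF mdist_nonneg y(2)[of \<one> 0]] by (simp add: S_def)
    define F where "F = {h \<in> carrier G. \<phi> h ` mcball_of m b r \<inter> mcball_of m b r \<noteq> {}}"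
    have "compactin (mtopology_of m) (mcball_of m b r)"
      using rh(2) b unfolding proper_metric_def by blast
    then have F: "finite F"
      using rh(4) unfolding properly_discontinuous_def F_def by blast
    have "\<beta> i s \<in> F" if i: "i \<in> I" and s: "s \<in> S" for i s
    proof -
      have h: "\<beta> i s \<in> carrier G" using auto_closed[OF \<beta>] s S by blast
      have "d b (\<phi> (\<beta> i s) b) \<le> d b (x i) + d (x i) (\<phi> (\<beta> i s) (x i)) + d (\<phi> (\<beta> i s) (x i)) (\<phi> (\<beta> i s) b)"
        using mdist_triangle[of b m "x i" "\<phi> (\<beta> i s) b"]
          mdist_triangle[of "x i" m "\<phi> (\<beta> i s) (x i)" "\<phi> (\<beta> i s) b"] h b xM by simp
      also have "\<dots> \<le> r"
        using displ[OF s, of i] i h b xM by (simp add: r_def I_def mdist_commute)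
      finally have "\<phi> (\<beta> i s) b \<in> mcball_of m b r" using h b by simp
      moreover have "d b b = 0" using b by simp
      then have "d b b \<le> r" using C0 unfolding r_def by linarith
      then have "b \<in> mcball_of m b r" using b by simp
      ultimately have "\<phi> (\<beta> i s) b \<in> \<phi> (\<beta> i s) ` mcball_of m b r \<inter> mcball_of m b r"
        by blast
      then show ?thesis using h unfolding F_def by blast
    qed
    then show ?thesis using fin_case[OF I F] by blast
  qed
qed

lemma (in group) relatively_hyperbolic_pointwise_inner_power_inner:
  assumes rh: "relatively_hyperbolic G"
    and \<alpha>: "\<alpha> \<in> auto G" and inner: "\<And>x. x \<in> carrier G \<Longrightarrow> conj_in G x (\<alpha> x)"
  shows "\<exists>n>0. \<alpha> [^]\<^bsub>AutoGroup G\<^esub> (n::nat) \<in> Inn G"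
proof -
  obtain P and m :: "real metric" and \<phi> where act: "rel_hyp_action G P m \<phi>"
    and P: "carrier G \<notin> P" and fg: "fin_gen G (carrier G)"
    using rh unfolding relatively_hyperbolic_def hyperbolic_relative_to_def by blast
  then obtain \<delta> where "\<forall>w\<in>mspace m. \<forall>x\<in>mspace m. \<forall>y\<in>mspace m. \<forall>z\<in>mspace m.
      min (gromov_prod m w x y) (gromov_prod m w y z) - \<delta> \<le> gromov_prod m w x z"
    unfolding rel_hyp_action_def gromov_hyperbolic_def by blast
  moreover have "isometric_action G m \<phi>" using act by (simp add: rel_hyp_action_def)
  ultimately interpret hyperbolic_action m \<delta> G \<phi> by unfold_locales auto
  show ?thesis using pointwise_inner_power_inner[OF act P fg \<alpha> inner] .
qed

theorem theorem2p3:
  fixes G :: "('a, 'b) monoid_scheme" and H :: "('a \<Rightarrow> 'a) set set"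
  assumes "group G"
    and "conjugacy_separable G"
    and "relatively_hyperbolic G"
    and "subgroup H (OutGroup G)"
    and "virtually_torsion_free ((OutGroup G)\<lparr>carrier := H\<rparr>)"
  shows "residually_finite ((OutGroup G)\<lparr>carrier := H\<rparr>)"
proof -
  interpret group G by fact
  let ?p = "\<lambda>\<alpha>. Inn G #>\<^bsub>AutoGroup G\<^esub> \<alpha>" and ?H = "(OutGroup G)\<lparr>carrier := H\<rparr>"
  interpret p: group_hom "AutoGroup G" "OutGroup G" ?p by (rule Out_hom)
  interpret H: group ?H using assms(4) p.H.subgroup_imp_group by blast
  have fg: "fin_gen G (carrier G)"
    using assms(3) by (auto simp: relatively_hyperbolic_def hyperbolic_relative_to_def)
  obtain H0 where H0: "finite_index ?H H0" "torsion_free (?H\<lparr>carrier := H0\<rparr>)"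
    using assms(5) by (auto simp: virtually_torsion_free_def)
  have sub0: "subgroup H0 ?H" using H0 by (simp add: finite_index_def)
  have "c = \<one>\<^bsub>?H\<^esub>" if c: "c \<in> \<Inter>{K. finite_index ?H K}" for c
  proof (rule ccontr)
    assume c1: "c \<noteq> \<one>\<^bsub>?H\<^esub>"
    \<comment> \<open>The torsion-free subgroup \<open>H0\<close> is itself one of the intersected
      subgroups.\<close>
    have cH0: "c \<in> H0" using c H0 by blast
    then have cH: "c \<in> H" using subgroup.subset[OF sub0] by auto
    then have "c \<in> carrier (OutGroup G)" using subgroup.subset[OF assms(4)] by blast
    then obtain \<alpha> where \<alpha>: "\<alpha> \<in> auto G" "c = ?p \<alpha>" using OutE by blast
    \<comment> \<open>Otherwise a positive power of \<alpha> is inner, which makes \<open>c\<close>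
      a nontrivial torsion element of \<open>H0\<close>.\<close>
    have "\<not> (\<forall>x\<in>carrier G. conj_in G x (\<alpha> x))"
    proof
      assume "\<forall>x\<in>carrier G. conj_in G x (\<alpha> x)"
      then obtain n :: nat where n: "n > 0" "\<alpha> [^]\<^bsub>AutoGroup G\<^esub> n \<in> Inn G"
        using relatively_hyperbolic_pointwise_inner_power_inner[OF assms(3) \<alpha>(1)] by blast
      have "c [^]\<^bsub>OutGroup G\<^esub> n = ?p (\<alpha> [^]\<^bsub>AutoGroup G\<^esub> n)"
        using p.hom_nat_pow[of \<alpha> n] \<alpha> by simp
      also have "\<dots> = \<one>\<^bsub>OutGroup G\<^esub>"
        using p.G.coset_join2[OF _ normal_imp_subgroup[OF Inn_normal] n(2)] p.G.nat_pow_closed[of \<alpha> n] \<alpha>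
        by (simp add: OutGroup_def FactGroup_def)
      finally have "c [^]\<^bsub>?H\<lparr>carrier := H0\<rparr>\<^esub> n = \<one>\<^bsub>?H\<lparr>carrier := H0\<rparr>\<^esub>"
        by (simp add: nat_pow_def)
      then show False
        using H0(2)[unfolded torsion_free_def, rule_format, of c n] cH0 c1 n(1) by simp
    qed
    then obtain x where x: "x \<in> carrier G" "\<not> conj_in G x (\<alpha> x)" by blast
    then obtain N where N: "N \<lhd> G" "finite (carrier (G Mod N))"
      "\<not> conj_in (G Mod N) (N #>\<^bsub>G\<^esub> x) (N #>\<^bsub>G\<^esub> \<alpha> x)"
      using assms(2) auto_closed[OF \<alpha>(1)] unfolding conjugacy_separable_def by blast
    have hom: "group_hom G (G Mod N) (\<lambda>y. N #>\<^bsub>G\<^esub> y)"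
      using normal.r_coset_hom_Mod[OF N(1)] normal.factorgroup_is_group[OF N(1)] is_group
      by (simp add: group_hom_def group_hom_axioms_def)
    \<comment> \<open>A conjugator for the whole quotient map would in particular conjugate the
      images of \<open>x\<close> and \<open>\<alpha> x\<close>.\<close>
    have "\<alpha> \<notin> class_stabilizer G (G Mod N) (\<lambda>y. N #>\<^bsub>G\<^esub> y)"
      using N(3) x(1) by (auto simp: class_stabilizer_def conj_in_def)
    then obtain K where "finite_index ?H K" "?p \<alpha> \<notin> K"
      using finite_index_excluding[OF hom N(2) fg assms(4) \<alpha>(1)] by blast
    then show False using c \<alpha>(2) by blast
  qed
  moreover have "\<one>\<^bsub>?H\<^esub> \<in> K" if "finite_index ?H K" for K
    using that subgroup.one_closed[of K ?H] by (simp add: finite_index_def)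
  ultimately show ?thesis unfolding residually_finite_def by blast
qed

end
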